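(* Let $n\geq 4$ and $k\geq 1$ be integers, and let $\varphi\colon\mathbb{P}^{\frac{n(n-1)}{2}-1}\dashrightarrow\mathbb{P}^{\frac{n(n-1)}{2}-1}$ be the Cremona transformation given on $\{x_{01}\neq 0\}$, with $x_{01}=1$, by $$y_{ij}=x_{ij}\quad\text{if } i\in\{0,1\},\ 2\leq j\leq n-1,\qquad y_{ij}=x_{ij}-x_{0i}x_{1j}+x_{0j}x_{1i}\quad\text{if }2\leq i<j\leq n-1.$$ Then $\varphi$ maps $\mathrm{Sec}_k(G(2,n))$ to the cone over $\mathrm{Sec}_{k-1}(G(2,n-2))$, where $G(2,n-2)$ lies in its Plücker embedding in the projective space with homogeneous coordinates $[y_{ij}]_{2\leq i<j\leq n-1}$, and the vertex of the cone is the linear image $\{y_{ij}=0: 2\leq i<j\leq n-1\}$ of $G(2,n)$ under $\varphi$.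
   Context: Everything is over $\mathbb{C}$. $G(2,n)\subset\mathbb{P}(\wedge^2\mathbb{C}^n)=\mathbb{P}^{\frac{n(n-1)}{2}-1}$ is the Grassmannian of $2$-dimensional vector subspaces of $\mathbb{C}^n$ in its Plücker embedding, with Plücker coordinates $[x_{ij}]_{0\leq i<j\leq n-1}$; the ambient space is identified with nonzero antisymmetric $n\times n$ matrices modulo nonzero scalars, and $G(2,n)$ is the locus of rank-$2$ matrices ($G(2,2)$ is a point, equal to $\mathbb{P}^0$). The target has homogeneous coordinates $[y_{ij}]_{0\leq i<j\leq n-1}$; in homogeneous coordinates $\varphi$ reads $y_{01}=x_{01}^2$, $y_{ij}=x_{01}x_{ij}$ for $i\in\{0,1\}$, $j\geq 2$, and $y_{ij}=x_{01}x_{ij}-x_{0i}x_{1j}+x_{0j}x_{1i}$ for $2\leq i<j\leq n-1$. For $X\subset\mathbb{P}^N$ and $k\geq0$, the $k$-secant variety $\mathrm{Sec}_k(X)$ is the Zariski closure of the union of all linear spaces of dimension $k$ that contain $k+1$ linearly independent points of $X$ (so $\mathrm{Sec}_0(X)=X$); for nondegenerate $X$ and $k\geq N$ it is understood to be $\mathbb{P}^N$. The image of a variety under $\varphi$ is the Zariski closure of the image of its intersection with $\{x_{01}\neq 0\}$. The cone over a subvariety $W$ of the projective space with coordinates $[y_{ij}]_{2\leq i<j\leq n-1}$ with vertex $L=\{y_{ij}=0:2\leq i<j\leq n-1\}$ is the set of points of $\mathbb{P}^{\frac{n(n-1)}{2}-1}$ that either lie in $L$ or satisfy $[y_{ij}]_{2\leq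 i<j\leq n-1}\in W$. *)

theory Defs
  imports Complex_Main "HOL-Library.Function_Algebras"
begin

section \<open>Projective spaces with a finite set of coordinates\<close>

text \<open>
  The vector space of complex vectors with coordinates indexed by a set \<open>I\<close> consists of the
  functions vanishing outside \<open>I\<close>. A point of the projective space is the set of all nonzero
  multiples of a nonzero vector.
\<close>

definition cscale :: "complex \<Rightarrow> ('i \<Rightarrow> complex) \<Rightarrow> ('i \<Rightarrow> complex)" where
  "cscale c x = (\<lambda>i. c * x i)"

global_interpretation cvec: vector_space cscale
  by standard (auto simp: cscale_def fun_eq_iff algebra_simps)

definition vecs :: "'i set \<Rightarrow> ('i \<Rightarrow> complex) set" where
  "vecs I = {x. \<forall>i. i \<notin> I \<longrightarrow> x i = 0}"

definition proj_point :: "('i \<Rightarrow> complex) \<Rightarrow> ('i \<Rightarrow> complex) set" where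
  "proj_point x = {cscale c x |c. c \<noteq> 0}"

definition projectivization :: "('i \<Rightarrow> complex) set \<Rightarrow> ('i \<Rightarrow> complex) set set" where
  "projectivization V = proj_point ` (V - {0})"

definition proj_space :: "'i set \<Rightarrow> ('i \<Rightarrow> complex) set set" where
  "proj_space I = projectivization (vecs I)"

definition linear_space :: "'i set \<Rightarrow> nat \<Rightarrow> ('i \<Rightarrow> complex) set set \<Rightarrow> bool" where
  "linear_space I k \<Lambda> \<longleftrightarrow>
     (\<exists>V. cvec.subspace V \<and> V \<subseteq> vecs I \<and> cvec.dim V = k + 1 \<and> \<Lambda> = projectivization V)"

definition nondegenerate :: "'i set \<Rightarrow> ('i \<Rightarrow> complex) set set \<Rightarrow> bool" where
  "nondegenerate I X \<longleftrightarrow>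
     (\<forall>V. cvec.subspace V \<and> V \<subseteq> vecs I \<and> X \<subseteq> projectivization V \<longrightarrow> V = vecs I)"

section \<open>Zariski closure\<close>

text \<open>Exponent vectors of the monomials of degree \<open>d\<close>, and the homogeneous polynomial of
  degree \<open>d\<close> with coefficient family \<open>c\<close>.\<close>

definition monomials :: "'i set \<Rightarrow> nat \<Rightarrow> ('i \<Rightarrow> nat) set" where
  "monomials I d = {m. (\<forall>i. i \<notin> I \<longrightarrow> m i = 0) \<and> (\<Sum>i\<in>I. m i) = d}"

definition hom_poly :: "'i set \<Rightarrow> nat \<Rightarrow> (('i \<Rightarrow> nat) \<Rightarrow> complex) \<Rightarrow> ('i \<Rightarrow> complex) \<Rightarrow> complex" where
  "hom_poly I d c x = (\<Sum>m\<in>monomials I d. c m * (\<Prod>i\<in>I. x i ^ m i))"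

definition zariski_closed :: "'i set \<Rightarrow> ('i \<Rightarrow> complex) set set \<Rightarrow> bool" where
  "zariski_closed I Z \<longleftrightarrow>
     (\<exists>F. Z = {P \<in> proj_space I. \<forall>(d, c)\<in>F. \<forall>x\<in>P. hom_poly I d c x = 0})"

definition zariski_closure :: "'i set \<Rightarrow> ('i \<Rightarrow> complex) set set \<Rightarrow> ('i \<Rightarrow> complex) set set" where
  "zariski_closure I S = zariski_closed I hull S"

section \<open>Secant varieties\<close>

definition secant_spaces ::
    "'i set \<Rightarrow> nat \<Rightarrow> ('i \<Rightarrow> complex) set set \<Rightarrow> ('i \<Rightarrow> complex) set set set" where
  "secant_spaces I k X =
     {\<Lambda>. linear_space I k \<Lambda> \<and>
         (\<exists>B. cvec.independent B \<and> card B = k + 1 \<and> proj_point ` B \<subseteq> X \<inter> \<Lambda>)}"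

text \<open>The first case is \<open>k \<ge> N\<close> for a nondegenerate subset of a projective space of dimension
  \<open>N = card I - 1\<close>.\<close>

definition Sec :: "'i set \<Rightarrow> nat \<Rightarrow> ('i \<Rightarrow> complex) set set \<Rightarrow> ('i \<Rightarrow> complex) set set" where
  "Sec I k X =
     (if nondegenerate I X \<and> card I \<le> k + 1 then proj_space I
      else zariski_closure I (\<Union>(secant_spaces I k X)))"

section \<open>Grassmannians of planes\<close>

text \<open>\<open>A\<close> is the set of indices of the coordinates of the vector space whose planes are
  parametrized, so that \<open>G(2,n)\<close> is \<open>Grass2 {0..<n}\<close>. Using \<open>{2..<n}\<close> instead gives \<open>G(2,n-2)\<close>
  in the projective space with coordinates indexed by the pairs \<open>2 \<le> i < j \<le> n-1\<close>.\<close>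

definition pairs :: "nat set \<Rightarrow> (nat \<times> nat) set" where
  "pairs A = {(i, j). i \<in> A \<and> j \<in> A \<and> i < j}"

definition pluecker :: "(nat \<Rightarrow> complex) \<Rightarrow> (nat \<Rightarrow> complex) \<Rightarrow> (nat \<times> nat \<Rightarrow> complex)" where
  "pluecker u v = (\<lambda>(i, j). if i < j then u i * v j - u j * v i else 0)"

definition planes :: "nat set \<Rightarrow> (nat \<Rightarrow> complex) set set" where
  "planes A = {V. cvec.subspace V \<and> V \<subseteq> vecs A \<and> cvec.dim V = 2}"

definition Grass2 :: "nat set \<Rightarrow> (nat \<times> nat \<Rightarrow> complex) set set" where
  "Grass2 A = {proj_point (pluecker u v) |u v. cvec.span {u, v} \<in> planes A}"

section \<open>Cones\<close>

text \<open>The coordinates indexed by \<open>J \<subseteq> I\<close> are those of the projective space containing the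
  base \<open>W\<close> of the cone.\<close>

definition restrict_vec :: "'i set \<Rightarrow> ('i \<Rightarrow> complex) \<Rightarrow> ('i \<Rightarrow> complex)" where
  "restrict_vec J y = (\<lambda>i. if i \<in> J then y i else 0)"

definition vertex :: "'i set \<Rightarrow> 'i set \<Rightarrow> ('i \<Rightarrow> complex) set set" where
  "vertex I J = projectivization {y \<in> vecs I. \<forall>i\<in>J. y i = 0}"

definition cone :: "'i set \<Rightarrow> 'i set \<Rightarrow> ('i \<Rightarrow> complex) set set \<Rightarrow> ('i \<Rightarrow> complex) set set" where
  "cone I J W =
     vertex I J \<union> {proj_point y |y. y \<in> vecs I - {0} \<and> proj_point (restrict_vec J y) \<in> W}"

section \<open>The Cremona transformation\<close>

definition cremona_affine :: "nat \<Rightarrow> (nat \<times> nat \<Rightarrow> complex) \<Rightarrow> (nat \<times> nat \<Rightarrow> complex)" where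
  "cremona_affine n x = (\<lambda>(i, j).
     if (i, j) \<notin> pairs {0..<n} then 0
     else if i = 0 \<and> j = 1 then 1
     else if i \<in> {0, 1} then x (i, j)
     else x (i, j) - x (0, i) * x (1, j) + x (0, j) * x (1, i))"

text \<open>On points of the chart \<open>x\<^sub>0\<^sub>1 \<noteq> 0\<close>: evaluate at the representative with \<open>x\<^sub>0\<^sub>1 = 1\<close>.\<close>

definition cremona ::
    "nat \<Rightarrow> (nat \<times> nat \<Rightarrow> complex) set \<Rightarrow> (nat \<times> nat \<Rightarrow> complex) set" where
  "cremona n P = proj_point (cremona_affine n (THE x. x \<in> P \<and> x (0, 1) = 1))"

definition chart01 :: "nat \<Rightarrow> (nat \<times> nat \<Rightarrow> complex) set set" where
  "chart01 n = {P \<in> proj_space (pairs {0..<n}). \<forall>x\<in>P. x (0, 1) \<noteq> 0}"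

definition cremona_image ::
    "nat \<Rightarrow> (nat \<times> nat \<Rightarrow> complex) set set \<Rightarrow> (nat \<times> nat \<Rightarrow> complex) set set" where
  "cremona_image n S = zariski_closure (pairs {0..<n}) (cremona n ` (S \<inter> chart01 n))"

lemma cremona_proj_point:
  assumes "x (0, 1) = 1"
  shows "cremona n (proj_point x) = proj_point (cremona_affine n x)"
proof -
  have "(THE y. y \<in> proj_point x \<and> y (0, 1) = 1) = x"
  proof (rule the_equality)
    show "x \<in> proj_point x \<and> x (0, 1) = 1"
      using assms by (auto simp: proj_point_def cscale_def intro!: exI[of _ 1])
  next
    fix y assume "y \<in> proj_point x \<and> y (0, 1) = 1"
    then show "y = x"
      using assms by (auto simp: proj_point_def cscale_def)
  qed
  then show ?thesis by (simp add: cremona_def)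
qed

lemma proj_point_cscale:
  assumes "c \<noteq> 0"
  shows "proj_point (cscale c x) = proj_point x"
proof -
  have "cscale a x \<in> proj_point (cscale c x)" if "a \<noteq> 0" for a
    unfolding proj_point_def using that assms
    by (auto simp: cscale_def fun_eq_iff intro!: exI[of _ "a / c"])
  moreover have "cscale a (cscale c x) \<in> proj_point x" if "a \<noteq> 0" for a
    unfolding proj_point_def using that assms
    by (auto simp: cscale_def fun_eq_iff intro!: exI[of _ "a * c"])
  ultimately show ?thesis
    unfolding proj_point_def by blast
qed

lemma cremona_homogeneous:
  assumes "x (0, 1) \<noteq> 0"
  shows "cremona n (proj_point x) = proj_point (\<lambda>(i, j).
     if (i, j) \<notin> pairs {0..<n} then 0
     else if i = 0 \<and> j = 1 then x (0, 1) ^ 2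
     else if i \<in> {0, 1} then x (0, 1) * x (i, j)
     else x (0, 1) * x (i, j) - x (0, i) * x (1, j) + x (0, j) * x (1, i))"
    (is "_ = proj_point ?h")
proof -
  define t where "t = x (0, 1)"
  have t: "t \<noteq> 0" using assms by (simp add: t_def)
  define x' where "x' = cscale (1 / t) x"
  have 1: "proj_point x = proj_point x'"
    using t by (simp add: x'_def proj_point_cscale)
  have 2: "x' (0, 1) = 1" using t by (simp add: x'_def cscale_def t_def)
  have "?h = cscale (t ^ 2) (cremona_affine n x')"
    using t unfolding x'_def t_def[symmetric]
    by (auto simp: fun_eq_iff cscale_def cremona_affine_def power2_eq_square field_simps)
  then show ?thesis
    using t by (simp add: 1 cremona_proj_point[of x', OF 2] proj_point_cscale)
qed

end

theory Submission
  imports Defs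
begin

text \<open>
  \<open>Sec\<^sub>k(G(2,n))\<close> is the closure of the locus of sums of \<open>k + 1\<close> decomposable bivectors. On the
  chart \<open>x\<^sub>0\<^sub>1 = 1\<close> the coordinates \<open>y\<^sub>i\<^sub>j\<close>, \<open>2 \<le> i < j\<close>, of the image of \<open>x\<close> are the Schur complement
  of the upper left \<open>2 \<times> 2\<close> block of the antisymmetric matrix \<open>x\<close>, so \<open>x\<close> is a sum of \<open>k + 1\<close>
  decomposables if and only if its Schur complement is a sum of \<open>k\<close> of them. Hence \<open>\<phi>\<close> carries this
  part of the locus onto the part \<open>y\<^sub>0\<^sub>1 = 1\<close> of the cone over the sums of \<open>k\<close> decomposables. To pass to
  closures, equations of \<open>Sec\<^sub>k\<^sub>-\<^sub>1(G(2,n-2))\<close> are pulled back along the quadratic Schur complement;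
  conversely, an equation of the image is split into its homogeneous components with respect to
  the coordinates \<open>y\<^sub>i\<^sub>j\<close>, \<open>2 \<le> i < j\<close>, each of which vanishes on \<open>Sec\<^sub>k\<^sub>-\<^sub>1(G(2,n-2))\<close>.
\<close>

section \<open>Homogeneous forms\<close>

text \<open>Forms are kept as functions rather than as coefficient families, so that sums, products
  and substitutions need no manipulation of coefficients.\<close>

definition forms :: "'i set \<Rightarrow> nat \<Rightarrow> (('i \<Rightarrow> complex) \<Rightarrow> complex) set" where
  "forms I d = range (hom_poly I d)"

lemma finite_monomials:
  assumes "finite I"
  shows "finite (monomials I d)"
proof -
  have "monomials I d \<subseteq> {m. \<forall>i. (i \<in> I \<longrightarrow> m i \<in> {..d}) \<and> (i \<notin> I \<longrightarrow> m i = 0)}"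
    using member_le_sum[OF _ _ assms] by (fastforce simp: monomials_def)
  then show ?thesis
    using finite_set_of_finite_funs[OF assms, of "{..d}" 0] by (meson finite_atMost finite_subset)
qed

lemma forms_zero: "(\<lambda>x. 0) \<in> forms I d"
  unfolding forms_def hom_poly_def by (rule image_eqI[of _ _ "\<lambda>m. 0"]) auto

lemma forms_add:
  assumes "f \<in> forms I d" "g \<in> forms I d"
  shows "(\<lambda>x. f x + g x) \<in> forms I d"
proof -
  obtain c c' where "f = hom_poly I d c" "g = hom_poly I d c'"
    using assms by (auto simp: forms_def)
  then have "(\<lambda>x. f x + g x) = hom_poly I d (\<lambda>m. c m + c' m)"
    by (auto simp: hom_poly_def sum.distrib algebra_simps)
  then show ?thesis by (auto simp: forms_def)
qed

lemma forms_scale: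
  assumes "f \<in> forms I d"
  shows "(\<lambda>x. a * f x) \<in> forms I d"
proof -
  obtain c where "f = hom_poly I d c"
    using assms by (auto simp: forms_def)
  then have "(\<lambda>x. a * f x) = hom_poly I d (\<lambda>m. a * c m)"
    by (auto simp: hom_poly_def sum_distrib_left algebra_simps)
  then show ?thesis by (auto simp: forms_def)
qed

lemma forms_diff:
  assumes "f \<in> forms I d" "g \<in> forms I d"
  shows "(\<lambda>x. f x - g x) \<in> forms I d"
  using forms_add[OF assms(1) forms_scale[OF assms(2), of "-1"]] by simp

lemma forms_sum:
  assumes "\<And>s. s \<in> S \<Longrightarrow> f s \<in> forms I d"
  shows "(\<lambda>x. \<Sum>s\<in>S. f s x) \<in> forms I d"
  using assms
  by (induction S rule: infinite_finite_induct) (auto intro: forms_zero forms_add)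

lemma forms_monomial:
  assumes "finite I" "m \<in> monomials I d"
  shows "(\<lambda>x. \<Prod>i\<in>I. x i ^ m i) \<in> forms I d"
proof -
  have "(\<lambda>x. \<Prod>i\<in>I. x i ^ m i) = hom_poly I d (\<lambda>m'. if m' = m then 1 else 0)"
  proof
    fix x :: "'a \<Rightarrow> complex"
    have "hom_poly I d (\<lambda>m'. if m' = m then 1 else 0) x =
        (\<Sum>m'\<in>monomials I d. if m' = m then \<Prod>i\<in>I. x i ^ m' i else 0)"
      unfolding hom_poly_def by (rule sum.cong) auto
    then show "(\<Prod>i\<in>I. x i ^ m i) = hom_poly I d (\<lambda>m'. if m' = m then 1 else 0) x"
      using assms by (simp add: finite_monomials sum.delta)
  qed
  then show ?thesis by (auto simp: forms_def)
qed

lemma forms_mult: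
  assumes "finite I" "f \<in> forms I d" "g \<in> forms I e"
  shows "(\<lambda>x. f x * g x) \<in> forms I (d + e)"
proof -
  obtain c c' where f: "f = hom_poly I d c" and g: "g = hom_poly I e c'"
    using assms by (auto simp: forms_def)
  have "(\<lambda>x. f x * g x) = (\<lambda>x. \<Sum>m\<in>monomials I d. \<Sum>m'\<in>monomials I e.
      (c m * c' m') * (\<Prod>i\<in>I. x i ^ (m i + m' i)))"
    unfolding f g hom_poly_def sum_product
    by (intro ext sum.cong) (simp_all add: power_add prod.distrib)
  also have "\<dots> \<in> forms I (d + e)"
    using assms(1)
    by (intro forms_sum forms_scale forms_monomial) (auto simp: monomials_def sum.distrib)
  finally show ?thesis .
qed

lemma forms_one:
  assumes "finite I"
  shows "(\<lambda>x. 1) \<in> forms I 0"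
  using forms_monomial[OF assms, of "\<lambda>i. 0" 0] by (simp add: monomials_def)

lemma forms_coord:
  assumes "finite I" "i \<in> I"
  shows "(\<lambda>x. x i) \<in> forms I 1"
proof -
  have "(\<lambda>j. if j = i then 1 else 0) \<in> monomials I 1"
    using assms by (auto simp: monomials_def)
  from forms_monomial[OF assms(1) this]
  show ?thesis
    using assms by (simp add: if_distrib[of "\<lambda>k. _ ^ k"] cong: if_cong)
qed

lemma forms_power:
  assumes "finite I" "f \<in> forms I d"
  shows "(\<lambda>x. f x ^ k) \<in> forms I (d * k)"
proof (induction k)
  case 0
  then show ?case using forms_one[OF assms(1)] by simp
next
  case (Suc k)
  then show ?case using forms_mult[OF assms Suc] by simp
qed

lemma forms_prod:
  assumes "finite I" "\<And>s. s \<in> S \<Longrightarrow> f s \<in> forms I (e s)"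
  shows "(\<lambda>x. \<Prod>s\<in>S. f s x) \<in> forms I (\<Sum>s\<in>S. e s)"
  using assms(2)
  by (induction S rule: infinite_finite_induct)
    (auto intro!: forms_one forms_mult assms(1))

text \<open>This pulls equations back. It is applied to coordinate restriction with
  \<open>e = 1\<close> and to the quadratic Schur complement.\<close>

lemma forms_compose:
  assumes "finite I" "f \<in> forms J d" "\<And>j. j \<in> J \<Longrightarrow> (\<lambda>x. \<sigma> x j) \<in> forms I e"
  shows "(\<lambda>x. f (\<sigma> x)) \<in> forms I (e * d)"
proof -
  obtain c where f: "f = hom_poly J d c"
    using assms by (auto simp: forms_def)
  have "(\<lambda>x. \<Prod>j\<in>J. \<sigma> x j ^ m j) \<in> forms I (e * d)" if "m \<in> monomials J d" for m
  proof -
    have "(\<lambda>x. \<Prod>j\<in>J. \<sigma> x j ^ m j) \<in> forms I (\<Sum>j\<in>J. e * m j)"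
      by (intro forms_prod forms_power assms)
    then show ?thesis
      using that by (simp add: monomials_def flip: sum_distrib_left)
  qed
  then show ?thesis
    unfolding f hom_poly_def by (intro forms_sum forms_scale)
qed

lemma forms_cscale:
  assumes "f \<in> forms I d"
  shows "f (cscale a x) = a ^ d * f x"
proof -
  obtain c where "f = hom_poly I d c"
    using assms by (auto simp: forms_def)
  then show ?thesis
    by (auto simp: hom_poly_def cscale_def power_mult_distrib prod.distrib sum_distrib_left
        monomials_def power_sum intro!: sum.cong)
qed

lemma forms_isCont_upd:
  assumes "f \<in> forms I d"
  shows "isCont (\<lambda>t. f (x(i := t))) a"
proof -
  obtain c where f: "f = hom_poly I d c"
    using assms by (auto simp: forms_def)
  have "isCont (\<lambda>t. (x(i := t)) j) a" for j
    by (cases "j = i") auto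
  then show ?thesis
    unfolding f hom_poly_def by (intro continuous_intros)
qed

text \<open>Along a coordinate line a form is continuous, so its values at
  \<open>t \<noteq> 0\<close> determine the value at 0. This later removes the condition that a
  chart coordinate is nonzero.\<close>

lemma forms_zero_by_continuity:
  assumes "f \<in> forms I d" "\<And>t. t \<noteq> 0 \<Longrightarrow> f (x(i := t)) = 0"
  shows "f x = 0"
proof (cases "x i = 0")
  case True
  have "((\<lambda>t. f (x(i := t))) \<longlongrightarrow> f (x(i := 0))) (at 0)"
    using forms_isCont_upd[OF assms(1)] by (simp add: isCont_def)
  moreover have "((\<lambda>t. f (x(i := t))) \<longlongrightarrow> 0) (at 0)"
    using assms(2) by (auto intro: tendsto_eventually simp: eventually_at_filter)
  ultimately have "f (x(i := 0)) = 0"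
    by (rule tendsto_unique[rotated]) simp
  with True show ?thesis by (metis fun_upd_triv)
next
  case False
  then show ?thesis using assms(2)[of "x i"] by simp
qed

lemma forms_graded_restriction:
  assumes "finite I" "J \<subseteq> I" "f \<in> forms I d"
  obtains h where "\<And>e. h e \<in> forms J e"
    "\<And>z. f (\<lambda>i. if i \<in> J then z i else w i) = (\<Sum>e\<le>d. h e z)"
proof -
  obtain c where f: "f = hom_poly I d c"
    using assms by (auto simp: forms_def)
  have J: "finite J" using assms finite_subset by blast
  define M where "M = monomials I d"
  define p where "p z m = c m * (\<Prod>i\<in>I - J. w i ^ m i) * (\<Prod>i\<in>J. z i ^ m i)" for z m
  define h where "h e z = (\<Sum>m\<in>{m \<in> M. sum m J = e}. p z m)" for e z
  have M: "finite M" unfolding M_def using assms finite_monomials by blast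
  show ?thesis
  proof
    fix e
    have "(\<lambda>z. \<Prod>i\<in>J. z i ^ m i) \<in> forms J e" if "sum m J = e" for m
    proof -
      have "(\<lambda>z. \<Prod>i\<in>J. z i ^ (if i \<in> J then m i else 0)) \<in> forms J e"
        using that by (intro forms_monomial J) (auto simp: monomials_def)
      then show ?thesis by simp
    qed
    then show "h e \<in> forms J e"
      unfolding h_def p_def by (intro forms_sum forms_scale) auto
  next
    fix z
    have "f (\<lambda>i. if i \<in> J then z i else w i) = (\<Sum>m\<in>M. p z m)"
      unfolding f hom_poly_def M_def[symmetric]
    proof (rule sum.cong)
      fix m assume "m \<in> M"
      have "(\<Prod>i\<in>I. (if i \<in> J then z i else w i) ^ m i) =
          (\<Prod>i\<in>I - J. (if i \<in> J then z i else w i) ^ m i) *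
          (\<Prod>i\<in>J. (if i \<in> J then z i else w i) ^ m i)"
        by (rule prod.subset_diff[OF assms(2,1)])
      then show "c m * (\<Prod>i\<in>I. (if i \<in> J then z i else w i) ^ m i) = p z m"
        by (simp add: p_def)
    qed auto
    also have "\<dots> = (\<Sum>e\<le>d. h e z)"
    proof -
      have "sum m J \<le> d" if "m \<in> M" for m
        using that sum_mono2[OF assms(1,2), of m] by (auto simp: M_def monomials_def)
      then have "sum (p z) M = (\<Sum>e\<in>{..d}. sum (p z) {m \<in> M. sum m J = e})"
        by (intro sum.group[symmetric] M) auto
      then show ?thesis by (simp add: h_def)
    qed
    finally show "f (\<lambda>i. if i \<in> J then z i else w i) = (\<Sum>e\<le>d. h e z)" .
  qed
qed

section \<open>Projective points and Zariski closure\<close>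

lemma subspace_vecs: "cvec.subspace (vecs I)"
  by (auto simp: cvec.subspace_def vecs_def cscale_def)

lemma mem_proj_point: "x \<in> proj_point x"
  by (auto simp: proj_point_def cscale_def intro!: exI[of _ 1])

lemma proj_point_eq_iff: "proj_point x = proj_point y \<longleftrightarrow> (\<exists>c. c \<noteq> 0 \<and> x = cscale c y)"
proof
  assume "proj_point x = proj_point y"
  then show "\<exists>c. c \<noteq> 0 \<and> x = cscale c y"
    using mem_proj_point[of x] by (auto simp: proj_point_def)
qed (auto simp: proj_point_cscale)

lemma proj_point_mem_image_iff:
  assumes "\<And>c x. c \<noteq> 0 \<Longrightarrow> x \<in> T \<Longrightarrow> cscale c x \<in> T"
  shows "proj_point x \<in> proj_point ` T \<longleftrightarrow> x \<in> T"
  using assms by (auto simp: proj_point_eq_iff)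

lemma proj_point_mem_projectivization_iff:
  assumes "\<And>c x. x \<in> V \<Longrightarrow> cscale c x \<in> V"
  shows "proj_point x \<in> projectivization V \<longleftrightarrow> x \<in> V \<and> x \<noteq> 0"
  unfolding projectivization_def using assms
  by (subst proj_point_mem_image_iff) (auto simp: cscale_def fun_eq_iff)

lemma proj_point_mem_proj_space_iff: "proj_point x \<in> proj_space I \<longleftrightarrow> x \<in> vecs I \<and> x \<noteq> 0"
  unfolding proj_space_def
  by (rule proj_point_mem_projectivization_iff) (auto simp: vecs_def cscale_def)

lemma zariski_closed_vanishing:
  "zariski_closed I {P \<in> proj_space I. \<forall>(d, c)\<in>F. \<forall>x\<in>P. hom_poly I d c x = 0}"
  by (auto simp: zariski_closed_def)

lemma form_vanishes_on_proj_point_iff: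
  assumes "f \<in> forms I d"
  shows "(\<forall>y\<in>proj_point x. f y = 0) \<longleftrightarrow> f x = 0"
  using mem_proj_point[of x] by (auto simp: proj_point_def forms_cscale[OF assms])

text \<open>Closures of sets of points become conditions on vectors: by homogeneity, a form can be
  tested on one representative of each point.\<close>

lemma zariski_closure_iff:
  assumes "T \<subseteq> vecs I - {0}"
  shows "proj_point x \<in> zariski_closure I (proj_point ` T) \<longleftrightarrow>
    x \<in> vecs I - {0} \<and> (\<forall>d. \<forall>f\<in>forms I d. (\<forall>t\<in>T. f t = 0) \<longrightarrow> f x = 0)"
proof -
  define F where "F = {(d, c). \<forall>t\<in>T. hom_poly I d c t = 0}"
  define Z where "Z = {P \<in> proj_space I. \<forall>(d, c)\<in>F. \<forall>x\<in>P. hom_poly I d c x = 0}"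
  have van: "(\<forall>y\<in>proj_point x. hom_poly I d c y = 0) \<longleftrightarrow> hom_poly I d c x = 0" for d c x
    by (rule form_vanishes_on_proj_point_iff) (auto simp: forms_def)
  have "zariski_closure I (proj_point ` T) = Z"
    unfolding zariski_closure_def
  proof (rule hull_unique)
    show "proj_point ` T \<subseteq> Z"
      using assms van by (fastforce simp: Z_def F_def proj_point_mem_proj_space_iff)
    show "zariski_closed I Z"
      unfolding Z_def by (rule zariski_closed_vanishing)
    fix Y assume Y: "proj_point ` T \<subseteq> Y" "zariski_closed I Y"
    then obtain G where G: "Y = {P \<in> proj_space I. \<forall>(d, c)\<in>G. \<forall>x\<in>P. hom_poly I d c x = 0}"
      by (auto simp: zariski_closed_def)
    \<comment> \<open>Every equation of \<open>Y\<close> vanishes on \<open>T\<close>, so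
      \<open>F\<close> imposes at least the conditions in \<open>G\<close>.\<close>
    have "G \<subseteq> F"
      using Y(1) mem_proj_point unfolding G F_def by fast
    then show "Z \<subseteq> Y"
      unfolding Z_def G by blast
  qed
  then show ?thesis
    by (auto simp: Z_def F_def van proj_point_mem_proj_space_iff forms_def)
qed

lemma zariski_closure_subset_proj_space:
  assumes "T \<subseteq> vecs I - {0}"
  shows "zariski_closure I (proj_point ` T) \<subseteq> proj_space I"
proof -
  have "zariski_closed I (proj_space I)"
    using zariski_closed_vanishing[of I "{}"] by simp
  moreover have "proj_point ` T \<subseteq> proj_space I"
    using assms by (auto simp: proj_point_mem_proj_space_iff)
  ultimately show ?thesis
    unfolding zariski_closure_def by (rule hull_minimal[rotated])
qed

lemma zariski_closure_subset:
  assumes "T \<subseteq> vecs I - {0}" "T' \<subseteq> vecs I - {0}" "proj_point ` T' \<subseteq> zariski_closure I (proj_point ` T)"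
  shows "zariski_closure I (proj_point ` T') \<subseteq> zariski_closure I (proj_point ` T)"
proof
  fix P assume P: "P \<in> zariski_closure I (proj_point ` T')"
  then obtain x where x: "P = proj_point x"
    using zariski_closure_subset_proj_space[OF assms(2)]
    by (auto simp: proj_space_def projectivization_def)
  have "f t = 0" if "f \<in> forms I d" "\<forall>t\<in>T. f t = 0" "t \<in> T'" for f d t
    using that assms(3) zariski_closure_iff[OF assms(1), of t] by blast
  then show "P \<in> zariski_closure I (proj_point ` T)"
    using P unfolding x zariski_closure_iff[OF assms(1)] zariski_closure_iff[OF assms(2)] by blast
qed

lemma zariski_closure_mono: "S \<subseteq> S' \<Longrightarrow> zariski_closure I S \<subseteq> zariski_closure I S'"
  unfolding zariski_closure_def by (rule hull_mono)

text \<open>Affine cones treat the origin uniformly. This matters because the restriction of a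
  nonzero vector may be 0, which has no projective point.\<close>

lemma affine_cone_zariski_closure_iff:
  assumes "finite J" "V \<subseteq> vecs J" "0 \<in> V" "z \<in> vecs J"
  shows "z = 0 \<or> proj_point z \<in> zariski_closure J (projectivization V) \<longleftrightarrow>
    (\<forall>d. \<forall>f\<in>forms J d. (\<forall>t\<in>V. f t = 0) \<longrightarrow> f z = 0)"
    (is "?L \<longleftrightarrow> ?R")
proof -
  have clos: "proj_point z \<in> zariski_closure J (projectivization V) \<longleftrightarrow>
      z \<in> vecs J - {0} \<and> (\<forall>d. \<forall>f\<in>forms J d. (\<forall>t\<in>V - {0}. f t = 0) \<longrightarrow> f z = 0)"
    unfolding projectivization_def using assms(2) by (intro zariski_closure_iff) auto
  have "f z = 0" if R: ?R and z: "z \<noteq> 0" and f: "f \<in> forms J d" "\<forall>t\<in>V - {0}. f t = 0" for f d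
  proof -
    obtain i where i: "z i \<noteq> 0" using z by (auto simp: fun_eq_iff)
    then have "i \<in> J" using assms(4) by (auto simp: vecs_def)
    \<comment> \<open>The factor makes the form vanish at \<open>0\<close> even if \<open>d = 0\<close>.\<close>
    then have "(\<lambda>x. x i * f x) \<in> forms J (1 + d)"
      using assms(1) f(1) by (intro forms_mult forms_coord)
    moreover have "\<forall>t\<in>V. t i * f t = 0" using f(2) by auto
    ultimately have "z i * f z = 0" using R[rule_format, of "\<lambda>x. x i * f x" "1 + d"] by blast
    with i show ?thesis by simp
  qed
  then show ?thesis
    using clos assms(3,4) by blast
qed

section \<open>Sums of decomposable bivectors\<close>

text \<open>These are the antisymmetric matrices of rank at most \<open>2 * m\<close>, stored by
  their upper triangle. Degenerate summands are allowed, so the sets increase with \<open>m\<close>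
  and are affine cones containing 0.\<close>

primrec wedge_sums :: "nat set \<Rightarrow> nat \<Rightarrow> (nat \<times> nat \<Rightarrow> complex) set" where
  "wedge_sums A 0 = {0}"
| "wedge_sums A (Suc m) =
     {pluecker u v + x |u v x. u \<in> vecs A \<and> v \<in> vecs A \<and> x \<in> wedge_sums A m}"

text \<open>For a subspace \<open>S\<close> this is its second exterior power inside the space of
  bivectors.\<close>

definition wedge2 :: "(nat \<Rightarrow> complex) set \<Rightarrow> (nat \<times> nat \<Rightarrow> complex) set" where
  "wedge2 S = cvec.span {pluecker u v |u v. u \<in> S \<and> v \<in> S}"

lemma pluecker_zero [simp]: "pluecker 0 v = 0" "pluecker u 0 = 0"
  by (auto simp: pluecker_def fun_eq_iff)

lemma pluecker_self [simp]: "pluecker u u = 0"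
  by (auto simp: pluecker_def fun_eq_iff)

lemma pluecker_cscale: "pluecker (cscale c u) v = cscale c (pluecker u v)"
  by (auto simp: pluecker_def fun_eq_iff cscale_def algebra_simps)

lemma pluecker_mem_vecs: "u \<in> vecs A \<Longrightarrow> v \<in> vecs A \<Longrightarrow> pluecker u v \<in> vecs (pairs A)"
  by (auto simp: pluecker_def vecs_def pairs_def)

lemma zero_mem_vecs [simp]: "0 \<in> vecs A"
  by (auto simp: vecs_def)

lemma zero_mem_wedge_sums: "0 \<in> wedge_sums A m"
proof (induction m)
  case 0
  show ?case unfolding wedge_sums.simps by (rule singletonI)
next
  case (Suc m)
  have "pluecker 0 0 + 0 \<in> wedge_sums A (Suc m)"
    using Suc zero_mem_vecs unfolding wedge_sums.simps by blast
  then show ?case by (simp only: pluecker_zero add_0)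
qed

lemma wedge_sums_SucI:
  assumes "u \<in> vecs A" "v \<in> vecs A" "x \<in> wedge_sums A m"
  shows "pluecker u v + x \<in> wedge_sums A (Suc m)"
  using assms by auto

lemma wedge_sums_mono:
  assumes "l \<le> m"
  shows "wedge_sums A l \<subseteq> wedge_sums A m"
proof -
  have "wedge_sums A m \<subseteq> wedge_sums A (Suc m)" for m
    using wedge_sums_SucI[OF zero_mem_vecs zero_mem_vecs] by fastforce
  then show ?thesis
    using assms lift_Suc_mono_le[of "wedge_sums A"] by blast
qed

lemma pluecker_mem_wedge_sums:
  assumes "u \<in> vecs A" "v \<in> vecs A" "m \<ge> 1"
  shows "pluecker u v \<in> wedge_sums A m"
  using wedge_sums_SucI[OF assms(1,2) zero_mem_wedge_sums, of 0] wedge_sums_mono[OF assms(3)]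
  by auto

lemma wedge_sums_subset_vecs: "wedge_sums A m \<subseteq> vecs (pairs A)"
proof (induction m)
  case (Suc m)
  then show ?case
    using pluecker_mem_vecs subspace_vecs by (fastforce intro: cvec.subspace_add)
qed simp

lemma wedge_sums_cscale: "x \<in> wedge_sums A m \<Longrightarrow> cscale c x \<in> wedge_sums A m"
proof (induction m arbitrary: x)
  case (Suc m)
  then obtain u v y where x: "x = pluecker u v + y" "u \<in> vecs A" "v \<in> vecs A" "y \<in> wedge_sums A m"
    by auto
  have "cscale c x = pluecker (cscale c u) v + cscale c y"
    by (simp add: x(1) cvec.scale_right_distrib pluecker_cscale)
  then show ?case
    using wedge_sums_SucI[of "cscale c u" A v "cscale c y" m] x Suc.IH
      cvec.subspace_scale[OF subspace_vecs] by metis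
qed (auto simp: cvec.scale_zero_right)

section \<open>Bivectors supported on a spanned subspace\<close>

lemma wedge2_mono: "S \<subseteq> T \<Longrightarrow> wedge2 S \<subseteq> wedge2 T"
  unfolding wedge2_def by (intro cvec.span_mono) blast

lemma pluecker_mem_wedge2: "u \<in> S \<Longrightarrow> v \<in> S \<Longrightarrow> pluecker u v \<in> wedge2 S"
  unfolding wedge2_def by (intro cvec.span_base) blast

lemma subspace_wedge2: "cvec.subspace (wedge2 S)"
  unfolding wedge2_def by (rule cvec.subspace_span)

text \<open>With \<open>W = span B\<close>, the second exterior power of the sum of \<open>W\<close>
  and the line of \<open>p\<close> is \<open>p \<and> W\<close> plus that of \<open>W\<close>: the
  right-hand side is a subspace containing all generators.\<close>

lemma wedge2_insert:
  assumes "x \<in> wedge2 (cvec.span (insert p B))"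
  obtains r y where "r \<in> cvec.span B" "y \<in> wedge2 (cvec.span B)" "x = pluecker p r + y"
proof -
  let ?T = "{pluecker p r + y |r y. r \<in> cvec.span B \<and> y \<in> wedge2 (cvec.span B)}"
  have "cvec.subspace ?T"
    unfolding cvec.subspace_def
  proof (intro conjI ballI allI)
    have "pluecker p 0 + 0 \<in> ?T"
      using cvec.span_zero cvec.subspace_0[OF subspace_wedge2] by blast
    then show "0 \<in> ?T" by simp
  next
    fix a b assume "a \<in> ?T" "b \<in> ?T"
    then obtain r y s z where "r \<in> cvec.span B" "y \<in> wedge2 (cvec.span B)"
      "s \<in> cvec.span B" "z \<in> wedge2 (cvec.span B)"
      and ab: "a = pluecker p r + y" "b = pluecker p s + z" by auto
    then have "r + s \<in> cvec.span B" "y + z \<in> wedge2 (cvec.span B)"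
      using cvec.span_add cvec.subspace_add[OF subspace_wedge2] by auto
    moreover have "a + b = pluecker p (r + s) + (y + z)"
      by (auto simp: ab pluecker_def fun_eq_iff algebra_simps)
    ultimately show "a + b \<in> ?T" by blast
  next
    fix c a assume "a \<in> ?T"
    then obtain r y where "r \<in> cvec.span B" "y \<in> wedge2 (cvec.span B)"
      and a: "a = pluecker p r + y" by auto
    then have "cscale c r \<in> cvec.span B" "cscale c y \<in> wedge2 (cvec.span B)"
      using cvec.span_scale cvec.subspace_scale[OF subspace_wedge2] by auto
    moreover have "cscale c a = pluecker p (cscale c r) + cscale c y"
      by (auto simp: a pluecker_def fun_eq_iff algebra_simps cscale_def)
    ultimately show "cscale c a \<in> ?T" by blast
  qed
  moreover have "{pluecker u v |u v. u \<in> cvec.span (insert p B) \<and> v \<in> cvec.span (insert p B)} \<subseteq> ?T"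
  proof clarify
    fix u v assume "u \<in> cvec.span (insert p B)" "v \<in> cvec.span (insert p B)"
    then obtain a b where "u - cscale a p \<in> cvec.span B" "v - cscale b p \<in> cvec.span B"
      by (auto simp: cvec.span_breakdown_eq)
    moreover define u' v' where "u' = u - cscale a p" "v' = v - cscale b p"
    ultimately have "cscale a v' - cscale b u' \<in> cvec.span B" "pluecker u' v' \<in> wedge2 (cvec.span B)"
      by (auto intro!: cvec.span_diff cvec.span_scale pluecker_mem_wedge2)
    \<comment> \<open>Expansion of \<open>(a p + u') \<and> (b p + v')\<close>, using
      \<open>p \<and> p = 0\<close>.\<close>
    moreover have "pluecker u v = pluecker p (cscale a v' - cscale b u') + pluecker u' v'"
      by (auto simp: u'_v'_def pluecker_def fun_eq_iff algebra_simps cscale_def)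
    ultimately show "\<exists>r y. pluecker u v = pluecker p r + y \<and> r \<in> cvec.span B \<and> y \<in> wedge2 (cvec.span B)"
      by blast
  qed
  ultimately have "wedge2 (cvec.span (insert p B)) \<subseteq> ?T"
    unfolding wedge2_def[of "cvec.span (insert p B)"] by (intro cvec.span_minimal)
  then show ?thesis using assms that by blast
qed

text \<open>A quantitative normal form of antisymmetric matrices: each decomposable summand uses up
  two vectors of the spanning set.\<close>

lemma wedge2_subset_wedge_sums:
  assumes "finite B" "B \<subseteq> vecs A" "x \<in> wedge2 (cvec.span B)"
  shows "x \<in> wedge_sums A (card B div 2)"
  using assms
proof (induction "card B" arbitrary: B x rule: less_induct)
  case less
  show ?case
  proof (cases "B = {}")
    case True
    then have "x = 0"
      using less.prems(3) by (simp add: wedge2_def)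
    then show ?thesis by (simp add: zero_mem_wedge_sums)
  next
    case False
    then obtain p B' where B: "B = insert p B'" "p \<notin> B'"
      by (meson Set.set_insert ex_in_conv)
    have finB': "finite B'" and cardB: "card B = Suc (card B')"
      using B less.prems(1) by auto
    obtain r y where r: "r \<in> cvec.span B'" and y: "y \<in> wedge2 (cvec.span B')"
      and x: "x = pluecker p r + y"
      using wedge2_insert less.prems(3) unfolding B(1) by metis
    have span_B': "cvec.span B' \<subseteq> vecs A"
      using B less.prems(2) by (intro cvec.span_minimal subspace_vecs) auto
    show ?thesis
    \<comment> \<open>If \<open>r \<noteq> 0\<close>, exchange \<open>r\<close> into a basis of \<open>span B'\<close>: then \<open>y = r \<and> s + z\<close> and
      \<open>x = (p - s) \<and> r + z\<close>, where \<open>z\<close> needs two vectors fewer.\<close>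
    proof (cases "r = 0")
      case True
      have "y \<in> wedge_sums A (card B' div 2)"
        using less.hyps[of B' y] finB' y cardB B less.prems(2) by auto
      then show ?thesis
        using True x cardB wedge_sums_mono[of "card B' div 2" "card B div 2" A]
        by (auto simp: div_le_mono)
    next
      case False
      then have "cvec.independent {r}"
        by (simp add: cvec.dependent_single)
      then obtain E where E: "{r} \<subseteq> E" "E \<subseteq> cvec.span B'" "cvec.independent E"
        "cvec.span B' \<subseteq> cvec.span E"
        using cvec.maximal_independent_subset_extend[of "{r}" "cvec.span B'"] r by auto
      have finE: "finite E" "card E \<le> card B'"
        using cvec.independent_span_bound[OF finB' E(3,2)] by auto
      define C where "C = E - {r}"
      have C: "E = insert r C" "finite C" "card E = Suc (card C)" "C \<subseteq> vecs A"
        using E(1,2) finE(1) span_B' card.remove[of E r] by (auto simp: C_def)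
      have "y \<in> wedge2 (cvec.span (insert r C))"
        using y wedge2_mono[OF E(4)] C(1) by auto
      then obtain s z where s: "s \<in> cvec.span C" and z: "z \<in> wedge2 (cvec.span C)"
        and y_eq: "y = pluecker r s + z"
        using wedge2_insert by metis
      have "cvec.span C \<subseteq> vecs A"
        using C(4) by (intro cvec.span_minimal subspace_vecs)
      then have ps: "p - s \<in> vecs A"
        using s less.prems(2) B cvec.subspace_diff[OF subspace_vecs] by blast
      have "z \<in> wedge_sums A (card C div 2)"
        using less.hyps[of C z] C finE cardB z by auto
      then have "pluecker (p - s) r + z \<in> wedge_sums A (Suc (card C div 2))"
        using ps r span_B' by (intro wedge_sums_SucI) auto
      moreover have "x = pluecker (p - s) r + z"
        by (auto simp: x y_eq pluecker_def fun_eq_iff algebra_simps)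
      \<comment> \<open>Here \<open>card C + 2 \<le> card B\<close>: one vector is lost with
        \<open>p\<close> and another with \<open>r\<close>.\<close>
      moreover have "Suc (card C div 2) \<le> card B div 2"
        using C(3) finE(2) cardB by linarith
      ultimately show ?thesis using wedge_sums_mono by blast
    qed
  qed
qed

text \<open>Together with \<open>wedge2_subset_wedge_sums\<close> this turns the number of summands
  into a count of spanning vectors, to which basis exchange applies.\<close>

lemma wedge_sums_support:
  assumes "x \<in> wedge_sums A m"
  obtains U where "finite U" "card U \<le> 2 * m" "U \<subseteq> vecs A" "x \<in> wedge2 (cvec.span U)"
  using assms
proof (induction m arbitrary: x thesis)
  case 0
  then show ?case
    using cvec.subspace_0[OF subspace_wedge2] by (auto intro!: 0(1)[of "{}"])
next
  case (Suc m)
  obtain u v y where x: "x = pluecker u v + y" "u \<in> vecs A" "v \<in> vecs A" "y \<in> wedge_sums A m"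
    using Suc.prems(2) by auto
  obtain U where U: "finite U" "card U \<le> 2 * m" "U \<subseteq> vecs A" "y \<in> wedge2 (cvec.span U)"
    using Suc.IH[OF _ x(4)] by blast
  show ?case
  proof (rule Suc.prems(1))
    show "card (insert u (insert v U)) \<le> 2 * Suc m"
      using U(1,2) by (simp add: card_insert_if)
    have "y \<in> wedge2 (cvec.span (insert u (insert v U)))"
      using U(4) wedge2_mono[OF cvec.span_mono[of U "insert u (insert v U)"]] by blast
    moreover have "pluecker u v \<in> wedge2 (cvec.span (insert u (insert v U)))"
      by (intro pluecker_mem_wedge2 cvec.span_base) auto
    ultimately show "x \<in> wedge2 (cvec.span (insert u (insert v U)))"
      unfolding x(1) by (intro cvec.subspace_add[OF subspace_wedge2])
  qed (use U x in auto)
qed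

section \<open>Schur complements and the number of decomposable summands\<close>

definition row :: "nat \<Rightarrow> (nat \<times> nat \<Rightarrow> complex) \<Rightarrow> nat \<Rightarrow> complex" where
  "row i x = (\<lambda>j. if i < j then x (i, j) else if j < i then - x (j, i) else 0)"

text \<open>Taking row \<open>i\<close> is contraction with the coordinate functional
  \<open>i\<close>, which sends \<open>u \<and> v\<close> to a combination of \<open>u\<close> and
  \<open>v\<close>.\<close>

lemma row_mem:
  assumes "cvec.subspace S" "x \<in> wedge2 S"
  shows "row i x \<in> S"
proof -
  have "row i (pluecker u v) = cscale (u i) v - cscale (v i) u" for u v
    by (auto simp: row_def pluecker_def cscale_def fun_eq_iff)
  moreover have "row i (x + y) = row i x + row i y" "row i (cscale c x) = cscale c (row i x)"
    "row i 0 = 0" for x y c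
    by (auto simp: row_def cscale_def fun_eq_iff)
  moreover have "cscale a v - cscale b u \<in> S" if "u \<in> S" "v \<in> S" for a b u v
    using that assms(1) by (intro cvec.subspace_diff cvec.subspace_scale)
  ultimately have "cvec.subspace {x. row i x \<in> S}"
    "{pluecker u v |u v. u \<in> S \<and> v \<in> S} \<subseteq> {x. row i x \<in> S}"
    using assms(1)
    by (auto simp: cvec.subspace_def[of "Collect _"] intro: cvec.subspace_0 cvec.subspace_add
        cvec.subspace_scale)
  then have "wedge2 S \<subseteq> {x. row i x \<in> S}"
    unfolding wedge2_def by (intro cvec.span_minimal)
  then show ?thesis using assms(2) by blast
qed

text \<open>The entries are the Pfaffians on the indices 0, 1, \<open>i\<close>, \<open>j\<close>.
  The factor \<open>x (0, 1)\<close> makes them quadratic forms that also make sense off the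
  chart.\<close>

definition schur :: "nat \<Rightarrow> (nat \<times> nat \<Rightarrow> complex) \<Rightarrow> nat \<times> nat \<Rightarrow> complex" where
  "schur n x = (\<lambda>(i, j). if (i, j) \<in> pairs {2..<n}
     then x (0, 1) * x (i, j) - x (0, i) * x (1, j) + x (0, j) * x (1, i) else 0)"

text \<open>Rows 0 and 1 of \<open>x\<close> are two independent vectors in a support spanned by at
  most \<open>2 * k + 2\<close> vectors. Splitting them off leaves at most \<open>2 * k\<close>
  vectors with zero coordinates 0 and 1, and the Schur complement lives on these.\<close>

lemma schur_mem_wedge_sums:
  assumes x: "x \<in> wedge_sums {0..<n} (Suc k)" and x01: "x (0, 1) = 1"
  shows "schur n x \<in> wedge_sums {2..<n} k"
proof -
  let ?A = "{0..<n}" and ?A' = "{2..<n}"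
  obtain U where U: "finite U" "card U \<le> 2 * Suc k" "U \<subseteq> vecs ?A" "x \<in> wedge2 (cvec.span U)"
    using wedge_sums_support[OF x] .
  \<comment> \<open>The sign makes the coordinates of \<open>p\<close> and \<open>q\<close> at the
    indices 0 and 1 equal to (1, 0) and (0, 1).\<close>
  define p q where "p = - row 1 x" and "q = row 0 x"
  have pq: "p 0 = 1" "p 1 = 0" "q 0 = 0" "q 1 = 1"
    using x01 by (auto simp: p_def q_def row_def)
  have pq_mem: "{p, q} \<subseteq> cvec.span U"
    using U(4) row_mem[OF cvec.subspace_span, of x U] cvec.span_neg by (auto simp: p_def q_def)
  have span_U: "cvec.span U \<subseteq> vecs ?A"
    using U(3) by (intro cvec.span_minimal subspace_vecs)
  have "p \<notin> cvec.span {q}"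
  proof
    assume "p \<in> cvec.span {q}"
    then obtain c where "p = cscale c q" by (auto simp: cvec.span_singleton)
    then show False using pq by (auto simp: cscale_def)
  qed
  moreover have "q \<noteq> 0" using pq(4) by auto
  ultimately have "cvec.independent {p, q}"
    by (simp add: cvec.independent_insert)
  then obtain E where E: "{p, q} \<subseteq> E" "E \<subseteq> cvec.span U" "cvec.independent E"
    "cvec.span U \<subseteq> cvec.span E"
    using cvec.maximal_independent_subset_extend[OF pq_mem] by blast
  have finE: "finite E" "card E \<le> card U"
    using cvec.independent_span_bound[OF U(1) E(3,2)] by auto
  \<comment> \<open>Subtracting multiples of \<open>p\<close> and \<open>q\<close> moves the rest of the basis into the common kernel
    of the coordinates 0 and 1.\<close>
  define g where "g b = b - cscale (b 0) p - cscale (b 1) q" for b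
  define C where "C = g ` (E - {p, q})"
  have "p \<noteq> q" using pq by auto
  then have "card (E - {p, q}) = card E - 2"
    using E(1) finE(1) by (subst card_Diff_subset) auto
  moreover have "card C \<le> card (E - {p, q})"
    unfolding C_def using finE(1) by (intro card_image_le) auto
  ultimately have C: "finite C" "card C \<le> 2 * k"
    using U(2) finE by (auto simp: C_def)
  have "C \<subseteq> vecs ?A'"
  proof
    fix b assume "b \<in> C"
    then obtain a where a: "a \<in> E" "b = g a" by (auto simp: C_def)
    have "b \<in> vecs ?A"
      unfolding a g_def using a(1) E(2) pq_mem span_U
      by (intro cvec.subspace_diff[OF subspace_vecs] cvec.subspace_scale[OF subspace_vecs]) auto
    moreover have "b 0 = 0" "b 1 = 0"
      using pq by (auto simp: a g_def cscale_def)
    ultimately show "b \<in> vecs ?A'"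
      by (auto simp: vecs_def numeral_2_eq_2 not_le less_Suc_eq)
  qed
  then have span_C: "cvec.span C \<subseteq> vecs ?A'"
    by (intro cvec.span_minimal subspace_vecs)
  have "E \<subseteq> cvec.span (insert p (insert q C))"
  proof
    fix b assume b: "b \<in> E"
    show "b \<in> cvec.span (insert p (insert q C))"
    proof (cases "b \<in> {p, q}")
      case True
      then show ?thesis by (intro cvec.span_base) auto
    next
      case False
      then have "g b + cscale (b 0) p + cscale (b 1) q \<in> cvec.span (insert p (insert q C))"
        using b by (intro cvec.span_add cvec.span_scale) (auto simp: C_def intro: cvec.span_base)
      then show ?thesis by (simp add: g_def)
    qed
  qed
  then have "cvec.span U \<subseteq> cvec.span (insert p (insert q C))"
    using E(4) cvec.span_minimal[OF _ cvec.subspace_span] by blast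
  then have "x \<in> wedge2 (cvec.span (insert p (insert q C)))"
    using U(4) wedge2_mono by blast
  then obtain r y where r: "r \<in> cvec.span (insert q C)"
    and y: "y \<in> wedge2 (cvec.span (insert q C))" and x_eq: "x = pluecker p r + y"
    using wedge2_insert by metis
  obtain s z where s: "s \<in> cvec.span C" and z: "z \<in> wedge2 (cvec.span C)"
    and y_eq: "y = pluecker q s + z"
    using wedge2_insert[OF y] by metis
  obtain c where c: "r - cscale c q \<in> cvec.span C"
    using r by (auto simp: cvec.span_breakdown_eq)
  define t where "t = r - cscale c q"
  have s01: "s 0 = 0" "s 1 = 0" and t01: "t 0 = 0" "t 1 = 0"
    using span_C s c by (auto simp: vecs_def t_def subset_iff)
  have z_mem: "z \<in> wedge_sums ?A' (card C div 2)"
    using wedge2_subset_wedge_sums[OF C(1) \<open>C \<subseteq> vecs ?A'\<close> z] .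
  then have z01: "z (0, 1) = 0"
    using wedge_sums_subset_vecs by (fastforce simp: vecs_def pairs_def)
  have "r = cscale c q + t" by (simp add: t_def)
  \<comment> \<open>As \<open>s\<close>, \<open>t\<close> and \<open>z\<close> do not involve the
    indices 0 and 1, only \<open>p \<and> c q\<close> contributes to this entry.\<close>
  then have "x (0, 1) = c"
    using pq s01 t01 z01 by (simp add: x_eq y_eq pluecker_def cscale_def)
  then have r_eq: "r = q + t" using x01 by (simp add: t_def)
  \<comment> \<open>Completing the product: \<open>p \<and> (q + t) + q \<and> s = (p - s) \<and> (q
    + t) + s \<and> t\<close>.\<close>
  define w where "w = pluecker s t + z"
  have "w \<in> wedge2 (cvec.span C)"
    unfolding w_def using s c z
    by (intro cvec.subspace_add[OF subspace_wedge2] pluecker_mem_wedge2) (auto simp: t_def)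
  then have w_mem: "w \<in> wedge_sums ?A' k"
    using wedge2_subset_wedge_sums[OF C(1) \<open>C \<subseteq> vecs ?A'\<close>] C(2)
      wedge_sums_mono[of "card C div 2" k] by fastforce
  have x_eq': "x = pluecker (p - s) (q + t) + w"
    by (auto simp: x_eq y_eq r_eq w_def pluecker_def fun_eq_iff algebra_simps)
  have w: "w \<in> vecs (pairs ?A')"
    using w_mem wedge_sums_subset_vecs by blast
  \<comment> \<open>By the Pluecker relation a decomposable bivector has zero Schur complement.
    Since \<open>w\<close> does not touch rows 0 and 1 and \<open>x (0, 1) = 1\<close>, exactly
    \<open>w\<close> remains.\<close>
  have "schur n x (i, j) = w (i, j)" for i j
  proof (cases "(i, j) \<in> pairs ?A'")
    case True
    then have "w (0, 1) = 0" "w (0, i) = 0" "w (0, j) = 0" "w (1, i) = 0" "w (1, j) = 0"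
      "0 < i" "0 < j" "1 < i" "1 < j" "i < j"
      using w by (auto simp: vecs_def pairs_def)
    then show ?thesis
      using True pq s01 t01 x01 by (simp add: schur_def) (simp add: x_eq' pluecker_def algebra_simps)
  next
    case False
    then show ?thesis using w by (auto simp: schur_def vecs_def)
  qed
  then have "schur n x = w" by auto
  then show ?thesis using w_mem by simp
qed

text \<open>One decomposable bivector built from rows 0 and 1 agrees with \<open>x\<close> in these
  rows, and what remains is the Schur complement.\<close>

lemma mem_wedge_sums_if_schur:
  assumes x: "x \<in> vecs (pairs {0..<n})" and x01: "x (0, 1) = 1"
    and "schur n x \<in> wedge_sums {2..<n} k"
  shows "x \<in> wedge_sums {0..<n} (Suc k)"
proof -
  have n: "n \<ge> 2"
  proof -
    have "(0, 1) \<in> pairs {0..<n}"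
      using x x01 unfolding vecs_def by (metis (mono_tags, lifting) mem_Collect_eq zero_neq_one)
    then show ?thesis by (simp add: pairs_def)
  qed
  \<comment> \<open>Since \<open>x (0, 1) = 1\<close>, these are minus row 1 and row 0 of
    \<open>x\<close>.\<close>
  define u v where "u i = (if i = 0 then 1 else if i \<in> {2..<n} then - x (1, i) else 0)"
    and "v i = (if i = 1 then 1 else if i \<in> {2..<n} then x (0, i) else 0)" for i :: nat
  have "u \<in> vecs {0..<n}" "v \<in> vecs {0..<n}"
    using n by (auto simp: u_def v_def vecs_def)
  moreover have "wedge_sums {2..<n} k \<subseteq> wedge_sums {0..<n} k"
  proof (induction k)
    case (Suc k)
    have "vecs {2..<n} \<subseteq> vecs {0..<n}"
      by (auto simp: vecs_def)
    with Suc show ?case by fastforce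
  qed simp
  moreover have "x (i, j) = (pluecker u v + schur n x) (i, j)" for i j
  proof (cases "(i, j) \<in> pairs {0..<n}")
    case True
    then have "i < j" "j < n" by (auto simp: pairs_def)
    then consider "i = 0" "j = 1" | "i = 0" "j \<ge> 2" | "i = 1" "j \<ge> 2" | "i \<ge> 2" "j \<ge> 2"
      by linarith
    then show ?thesis
      using \<open>i < j\<close> \<open>j < n\<close> x01
      by cases (auto simp: pluecker_def schur_def pairs_def u_def v_def algebra_simps)
  next
    case False
    then show ?thesis using x n
      by (auto simp: vecs_def pluecker_def schur_def u_def v_def pairs_def)
  qed
  ultimately show ?thesis
    using assms(3) wedge_sums_SucI[of u "{0..<n}" v "schur n x" k]
    by (subst ext[of x "pluecker u v + schur n x"]) auto
qed

lemma schur_cscale: "schur n (cscale c x) = cscale (c ^ 2) (schur n x)"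
  by (auto simp: schur_def cscale_def fun_eq_iff power2_eq_square algebra_simps)

text \<open>Pulled-back equations must vanish on all sums, also on those with
  \<open>x (0, 1) = 0\<close>. There the Schur complement is the single decomposable bivector of
  rows 1 and 0, which fits since \<open>k \<ge> 1\<close>; elsewhere rescaling reduces to the
  chart.\<close>

lemma schur_mem_wedge_sums_of_pos:
  assumes x: "x \<in> wedge_sums {0..<n} (Suc k)" and k: "k \<ge> 1"
  shows "schur n x \<in> wedge_sums {2..<n} k"
proof (cases "x (0, 1) = 0")
  case True
  define u v where "u i = (if i \<in> {2..<n} then x (1, i) else 0)"
    and "v i = (if i \<in> {2..<n} then x (0, i) else 0)" for i
  have "schur n x = pluecker u v"
    using True by (auto simp: schur_def pluecker_def u_def v_def pairs_def fun_eq_iff)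
  moreover have "u \<in> vecs {2..<n}" "v \<in> vecs {2..<n}"
    by (auto simp: u_def v_def vecs_def)
  ultimately show ?thesis using k pluecker_mem_wedge_sums by simp
next
  case False
  have "schur n (cscale (1 / x (0, 1)) x) \<in> wedge_sums {2..<n} k"
    using False by (intro schur_mem_wedge_sums wedge_sums_cscale x) (simp add: cscale_def)
  then have "cscale (x (0, 1) ^ 2) (schur n (cscale (1 / x (0, 1)) x)) \<in> wedge_sums {2..<n} k"
    by (rule wedge_sums_cscale)
  moreover have "cscale (x (0, 1) ^ 2) (schur n (cscale (1 / x (0, 1)) x)) = schur n x"
    using False by (simp add: schur_cscale power_one_over)
  ultimately show ?thesis by simp
qed

section \<open>Secant varieties of Grassmannians of planes\<close>

definition unit_vec :: "'i \<Rightarrow> 'i \<Rightarrow> complex" where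
  "unit_vec i = (\<lambda>j. if j = i then 1 else 0)"

lemma span_unit_vecs:
  assumes "finite K"
  shows "cvec.span (unit_vec ` K) = vecs K"
proof
  show "cvec.span (unit_vec ` K) \<subseteq> vecs K"
    by (intro cvec.span_minimal subspace_vecs) (auto simp: vecs_def unit_vec_def)
  have "x \<in> cvec.span (unit_vec ` K)" if "x \<in> vecs K" for x :: "'a \<Rightarrow> complex"
    using assms that
  proof (induction K arbitrary: x rule: finite_induct)
    case empty
    then have "x = 0" by (auto simp: vecs_def fun_eq_iff)
    then show ?case by (simp only: cvec.span_zero)
  next
    case (insert i K)
    have "x(i := 0) \<in> cvec.span (unit_vec ` K)"
      using insert.prems by (intro insert.IH) (auto simp: vecs_def)
    moreover have "x - cscale (x i) (unit_vec i) = x(i := 0)"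
      by (auto simp: cscale_def unit_vec_def)
    ultimately show ?case
      unfolding image_insert cvec.span_breakdown_eq by metis
  qed
  then show "vecs K \<subseteq> cvec.span (unit_vec ` K)" by blast
qed

lemma inj_unit_vec: "inj unit_vec"
  by (auto simp: inj_def unit_vec_def fun_eq_iff)

lemma dim_vecs:
  assumes "finite K"
  shows "cvec.dim (vecs K) = card K"
proof -
  have "cvec.independent (unit_vec ` K)"
    using assms
  proof (induction K rule: finite_induct)
    case (insert i K)
    have "unit_vec i \<notin> cvec.span (unit_vec ` K)"
      unfolding span_unit_vecs[OF insert.hyps(1)] using insert.hyps(2)
      by (auto simp: vecs_def unit_vec_def)
    with insert.IH show ?case by (simp add: cvec.independent_insertI)
  qed (simp add: cvec.independent_empty)
  then have "cvec.dim (cvec.span (unit_vec ` K)) = card (unit_vec ` K)"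
    by (rule cvec.dim_span_eq_card_independent)
  then show ?thesis
    using assms by (simp add: span_unit_vecs card_image[OF inj_on_subset[OF inj_unit_vec]])
qed

section \<open>Spans of decomposable bivectors\<close>

lemma mem_wedge_sums_one_iff:
  "x \<in> wedge_sums A (Suc 0) \<longleftrightarrow> (\<exists>u v. x = pluecker u v \<and> u \<in> vecs A \<and> v \<in> vecs A)"
  by auto

lemma unit_vec_mem_wedge_sums:
  assumes "p \<in> pairs A"
  shows "unit_vec p \<in> wedge_sums A (Suc 0)"
proof -
  obtain i j where p: "p = (i, j)" "i < j" "i \<in> A" "j \<in> A"
    using assms by (auto simp: pairs_def)
  have "unit_vec p = pluecker (unit_vec i) (unit_vec j)"
    using p by (auto simp: unit_vec_def pluecker_def fun_eq_iff)
  moreover have "unit_vec i \<in> vecs A" "unit_vec j \<in> vecs A"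
    using p by (auto simp: unit_vec_def vecs_def)
  ultimately show ?thesis
    unfolding mem_wedge_sums_one_iff by blast
qed

lemma span_subset_wedge_sums:
  assumes "finite S" "S \<subseteq> wedge_sums A (Suc 0)"
  shows "cvec.span S \<subseteq> wedge_sums A (card S)"
  using assms
proof (induction S rule: finite_induct)
  case (insert b S)
  show ?case
  proof
    fix x assume "x \<in> cvec.span (insert b S)"
    then obtain c where c: "x - cscale c b \<in> cvec.span S"
      by (auto simp: cvec.span_breakdown_eq)
    have "cscale c b \<in> wedge_sums A (Suc 0)"
      using insert.prems wedge_sums_cscale by blast
    then obtain u v where uv: "cscale c b = pluecker u v" "u \<in> vecs A" "v \<in> vecs A"
      unfolding mem_wedge_sums_one_iff by blast
    have "pluecker u v + (x - cscale c b) \<in> wedge_sums A (Suc (card S))"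
      using insert.IH insert.prems uv c by (intro wedge_sums_SucI) auto
    then show "x \<in> wedge_sums A (card (insert b S))"
      using insert.hyps by (simp flip: uv(1) del: wedge_sums.simps)
  qed
qed simp

lemma mem_span_if_mem_wedge_sums:
  assumes "x \<in> wedge_sums A m"
  obtains S where "finite S" "S \<subseteq> wedge_sums A (Suc 0)" "card S \<le> m" "x \<in> cvec.span S"
  using assms
proof (induction m arbitrary: x thesis)
  case 0
  then show ?case by (auto intro: 0(1)[of "{}"])
next
  case (Suc m)
  then obtain u v y where x: "x = pluecker u v + y" "u \<in> vecs A" "v \<in> vecs A" "y \<in> wedge_sums A m"
    by auto
  obtain S where S: "finite S" "S \<subseteq> wedge_sums A (Suc 0)" "card S \<le> m" "y \<in> cvec.span S"
    using Suc.IH[OF _ x(4)] by blast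
  show ?case
  proof (rule Suc.prems(1))
    show "insert (pluecker u v) S \<subseteq> wedge_sums A (Suc 0)"
      using S(2) pluecker_mem_wedge_sums[OF x(2,3), of "Suc 0"]
      by (simp del: wedge_sums.simps)
    show "card (insert (pluecker u v) S) \<le> Suc m"
      using S(1,3) by (simp add: card_insert_if)
    have "y \<in> cvec.span (insert (pluecker u v) S)"
      using S(4) cvec.span_mono[of S "insert (pluecker u v) S"] by blast
    then show "x \<in> cvec.span (insert (pluecker u v) S)"
      unfolding x(1) by (intro cvec.span_add) (auto intro: cvec.span_base)
  qed (use S in simp)
qed

text \<open>The coordinates of \<open>pluecker u v\<close> are the 2 by 2 minors of the pair, which
  all vanish exactly when the two vectors are dependent.\<close>

lemma span_pair_mem_planes_iff:
  "cvec.span {u, v} \<in> planes A \<longleftrightarrow> u \<in> vecs A \<and> v \<in> vecs A \<and> pluecker u v \<noteq> 0"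
proof -
  have "cvec.span {u, v} \<subseteq> vecs A \<longleftrightarrow> u \<in> vecs A \<and> v \<in> vecs A"
    using cvec.span_superset[of "{u, v}"] cvec.span_minimal[OF _ subspace_vecs, of "{u, v}" A]
    by blast
  moreover have "cvec.dim (cvec.span {u, v}) = 2 \<longleftrightarrow> pluecker u v \<noteq> 0"
  proof
    assume dim: "cvec.dim (cvec.span {u, v}) = 2"
    show "pluecker u v \<noteq> 0"
    proof
      assume 0: "pluecker u v = 0"
      have uv: "u i * v j = u j * v i" for i j
        using fun_cong[OF 0, of "(i, j)"] fun_cong[OF 0, of "(j, i)"]
        by (cases i j rule: linorder_cases) (auto simp: pluecker_def)
      have "\<exists>w. {u, v} \<subseteq> cvec.span {w}"
      proof (cases "u = 0")
        case True
        then show ?thesis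
          by (intro exI[of _ v]) (auto intro: cvec.span_zero cvec.span_base)
      next
        case False
        then obtain i where "u i \<noteq> 0" by (auto simp: fun_eq_iff)
        then have "v = cscale (v i / u i) u"
          using uv[of i] by (auto simp: cscale_def fun_eq_iff field_simps)
        then have "v \<in> cvec.span {u}"
          by (metis cvec.span_base cvec.span_scale singletonI)
        then show ?thesis
          by (intro exI[of _ u]) (auto intro: cvec.span_base)
      qed
      then obtain w where "{u, v} \<subseteq> cvec.span {w}" by blast
      then have "cvec.dim {u, v} \<le> 1"
        using cvec.dim_le_card[of "{u, v}" "{w}"] by simp
      with dim show False by simp
    qed
  next
    assume ne: "pluecker u v \<noteq> 0"
    have "u \<notin> cvec.span {v}"
    proof
      assume "u \<in> cvec.span {v}"
      then obtain c where "u = cscale c v" by (auto simp: cvec.span_singleton)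
      then show False using ne by (simp add: pluecker_cscale)
    qed
    moreover have "v \<noteq> 0" "u \<noteq> v" using ne by auto
    ultimately have "cvec.independent {u, v}" "card {u, v} = 2"
      by (auto simp: cvec.independent_insert)
    then show "cvec.dim (cvec.span {u, v}) = 2"
      by (metis cvec.dim_span_eq_card_independent)
  qed
  ultimately show ?thesis
    by (auto simp: planes_def)
qed

section \<open>Secant spaces and secant varieties\<close>

lemma Grass2_eq: "Grass2 A = projectivization (wedge_sums A (Suc 0))"
  unfolding Grass2_def projectivization_def span_pair_mem_planes_iff image_def
  by (simp only: mem_wedge_sums_one_iff Diff_iff singleton_iff Bex_def) blast

lemma proj_point_mem_wedge_sums_iff:
  "proj_point x \<in> projectivization (wedge_sums A m) \<longleftrightarrow> x \<in> wedge_sums A m \<and> x \<noteq> 0"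
  by (rule proj_point_mem_projectivization_iff) (rule wedge_sums_cscale)

lemma finite_pairs: "finite A \<Longrightarrow> finite (pairs A)"
  by (rule finite_subset[of _ "A \<times> A"]) (auto simp: pairs_def)

lemma proj_point_mem_projectivization_subspace_iff:
  assumes "cvec.subspace V"
  shows "proj_point x \<in> projectivization V \<longleftrightarrow> x \<in> V \<and> x \<noteq> 0"
  by (rule proj_point_mem_projectivization_iff) (rule cvec.subspace_scale[OF assms])

text \<open>The coordinate points lie on the Grassmannian and already span. This gives access to the
  first case of \<open>Sec\<close>.\<close>

lemma nondegenerate_Grass2:
  assumes "finite A"
  shows "nondegenerate (pairs A) (Grass2 A)"
  unfolding nondegenerate_def
proof (intro allI impI)
  fix V assume V: "cvec.subspace V \<and> V \<subseteq> vecs (pairs A) \<and> Grass2 A \<subseteq> projectivization V"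
  have "unit_vec p \<in> V" if "p \<in> pairs A" for p
  proof -
    have "unit_vec p p \<noteq> 0" by (simp add: unit_vec_def)
    then have "unit_vec p \<noteq> 0" by (metis zero_fun_apply)
    then have "proj_point (unit_vec p) \<in> Grass2 A"
      using unit_vec_mem_wedge_sums[OF that]
      unfolding Grass2_eq proj_point_mem_wedge_sums_iff by blast
    then show ?thesis
      using V proj_point_mem_projectivization_subspace_iff by blast
  qed
  then have "cvec.span (unit_vec ` pairs A) \<subseteq> V"
    using V by (intro cvec.span_minimal) auto
  then show "V = vecs (pairs A)"
    using V span_unit_vecs[OF finite_pairs[OF assms]] by auto
qed

lemma vecs_pairs_subset_wedge_sums:
  assumes "finite A" "card (pairs A) \<le> m"
  shows "vecs (pairs A) \<subseteq> wedge_sums A m"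
proof -
  have "vecs (pairs A) \<subseteq> wedge_sums A (card (unit_vec ` pairs A))"
    unfolding span_unit_vecs[OF finite_pairs[OF assms(1)], symmetric]
    using finite_pairs[OF assms(1)] unit_vec_mem_wedge_sums
    by (intro span_subset_wedge_sums) auto
  moreover have "card (unit_vec ` pairs A) \<le> m"
    using card_image_le[OF finite_pairs[OF assms(1)], of unit_vec] assms(2) by (rule le_trans)
  ultimately show ?thesis using wedge_sums_mono by blast
qed

text \<open>A secant space consists of combinations of \<open>k + 1\<close> decomposables.
  Conversely, a sum may involve fewer independent ones; these are enlarged to \<open>k + 1\<close>
  by coordinate bivectors, which are decomposable and numerous enough by the second
  assumption.\<close>

lemma Union_secant_spaces_Grass2:
  assumes "finite A" "Suc k \<le> card (pairs A)"
  shows "\<Union> (secant_spaces (pairs A) k (Grass2 A)) = projectivization (wedge_sums A (Suc k))"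
proof (intro equalityI subsetI)
  fix P assume "P \<in> \<Union> (secant_spaces (pairs A) k (Grass2 A))"
  then obtain V B where V: "cvec.subspace V" "cvec.dim V = k + 1" "P \<in> projectivization V"
    and B: "cvec.independent B" "card B = k + 1" "proj_point ` B \<subseteq> Grass2 A \<inter> projectivization V"
    by (auto simp: secant_spaces_def linear_space_def)
  have BV: "B \<subseteq> V" and BG: "B \<subseteq> wedge_sums A (Suc 0)"
    using B(3) V(1) unfolding Grass2_eq
    by (auto simp: proj_point_mem_wedge_sums_iff proj_point_mem_projectivization_subspace_iff
        simp del: wedge_sums.simps)
  have finB: "finite B" using B(2) card.infinite by fastforce
  \<comment> \<open>A vector outside the span would give \<open>k + 2\<close> independent vectors in
    dimension \<open>k + 1\<close>.\<close>
  have "V \<subseteq> cvec.span B"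
  proof (rule ccontr)
    assume "\<not> V \<subseteq> cvec.span B"
    then obtain v where v: "v \<in> V" "v \<notin> cvec.span B" by blast
    obtain E where E: "E \<subseteq> V" "cvec.independent E" "V \<subseteq> cvec.span E" "card E = cvec.dim V"
      using cvec.basis_exists by blast
    have "finite E" using E(4) V(2) card.infinite by fastforce
    moreover have "cvec.independent (insert v B)"
      using B(1) v(2) by (rule cvec.independent_insertI[rotated])
    ultimately have "card (insert v B) \<le> card E"
      using cvec.independent_span_bound[of E "insert v B"] BV v(1) E(3) by blast
    moreover have "v \<notin> B" using v(2) cvec.span_base by blast
    ultimately show False using finB B(2) E(4) V(2) by simp
  qed
  then have "V \<subseteq> wedge_sums A (Suc k)"
    using span_subset_wedge_sums[OF finB BG] B(2) by simp
  then show "P \<in> projectivization (wedge_sums A (Suc k))"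
    using V(3) by (auto simp: projectivization_def simp del: wedge_sums.simps)
next
  fix P assume "P \<in> projectivization (wedge_sums A (Suc k))"
  then obtain x where x: "P = proj_point x" "x \<in> wedge_sums A (Suc k)" "x \<noteq> 0"
    by (auto simp: projectivization_def simp del: wedge_sums.simps)
  obtain S where S: "finite S" "S \<subseteq> wedge_sums A (Suc 0)" "card S \<le> Suc k" "x \<in> cvec.span S"
    using mem_span_if_mem_wedge_sums[OF x(2)] .
  obtain B where B: "B \<subseteq> S" "cvec.independent B" "S \<subseteq> cvec.span B"
    using cvec.maximal_independent_subset by blast
  let ?T = "B \<union> unit_vec ` pairs A"
  obtain E where E: "B \<subseteq> E" "E \<subseteq> ?T" "cvec.independent E" "?T \<subseteq> cvec.span E"
    using cvec.maximal_independent_subset_extend[OF Un_upper1 B(2)] by blast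
  have T: "?T \<subseteq> wedge_sums A (Suc 0)"
    using B(1) S(2) unit_vec_mem_wedge_sums by blast
  then have EG: "E \<subseteq> wedge_sums A (Suc 0)" using E(2) by blast
  have "finite ?T"
    using finite_subset[OF B(1) S(1)] finite_pairs[OF assms(1)] by simp
  then have finE: "finite E" using E(2) finite_subset by blast
  have "vecs (pairs A) \<subseteq> cvec.span E"
    using E(4) cvec.span_minimal[OF _ cvec.subspace_span, of "unit_vec ` pairs A" E]
      span_unit_vecs[OF finite_pairs[OF assms(1)]] by blast
  then have "card (pairs A) \<le> card E"
    using cvec.dim_le_card[OF _ finE] dim_vecs[OF finite_pairs[OF assms(1)]] by metis
  moreover have "card B \<le> Suc k"
    using card_mono[OF S(1) B(1)] S(3) by linarith
  \<comment> \<open>\<open>E\<close> is a basis of the ambient space containing \<open>B\<close>, so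
    exactly \<open>k + 1\<close> of its members can be chosen around \<open>B\<close>.\<close>
  ultimately obtain C where C: "B \<subseteq> C" "C \<subseteq> E" "card C = Suc k"
    using exists_subset_between[of B "Suc k" E] E(1) finE assms(2) by auto
  have indC: "cvec.independent C"
    using E(3) C(2) cvec.independent_mono by blast
  have CV: "C \<subseteq> vecs (pairs A)"
    using C(2) EG wedge_sums_subset_vecs by blast
  have C0: "0 \<notin> C"
    using indC cvec.dependent_zero by blast
  have "x \<in> cvec.span C"
    using S(4) B(3) cvec.span_mono[OF C(1)] cvec.span_minimal[OF B(3) cvec.subspace_span] by blast
  then have "P \<in> projectivization (cvec.span C)"
    unfolding x(1) using x(3) by (simp add: proj_point_mem_projectivization_subspace_iff)
  moreover have "projectivization (cvec.span C) \<in> secant_spaces (pairs A) k (Grass2 A)"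
    unfolding secant_spaces_def linear_space_def mem_Collect_eq
  proof (intro conjI exI)
    show "cvec.span C \<subseteq> vecs (pairs A)"
      using CV by (intro cvec.span_minimal subspace_vecs)
    show "cvec.dim (cvec.span C) = k + 1"
      using cvec.dim_span_eq_card_independent[OF indC] C(3) by simp
    have "c \<in> wedge_sums A (Suc 0)" "c \<noteq> 0" if "c \<in> C" for c
      using that C(2) EG C0 by blast+
    then show "proj_point ` C \<subseteq> Grass2 A \<inter> projectivization (cvec.span C)"
      by (auto simp: Grass2_eq proj_point_mem_wedge_sums_iff
        proj_point_mem_projectivization_subspace_iff cvec.span_base simp del: wedge_sums.simps)
  qed (use indC C(3) in auto)
  ultimately show "P \<in> \<Union> (secant_spaces (pairs A) k (Grass2 A))" by blast
qed

text \<open>Both cases of \<open>Sec\<close> obey one formula: if \<open>k + 1\<close> is at least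
  the number of coordinates, multiples of coordinate bivectors already sum to every
  bivector.\<close>

lemma Sec_Grass2:
  assumes "finite A"
  shows "Sec (pairs A) k (Grass2 A) =
    zariski_closure (pairs A) (projectivization (wedge_sums A (Suc k)))"
proof (cases "card (pairs A) \<le> k + 1")
  case True
  then have "wedge_sums A (Suc k) = vecs (pairs A)"
    using vecs_pairs_subset_wedge_sums[OF assms, of "Suc k"]
      wedge_sums_subset_vecs[of A "Suc k"] by auto
  moreover have "zariski_closure (pairs A) (projectivization (vecs (pairs A))) \<subseteq> proj_space (pairs A)"
    unfolding projectivization_def by (intro zariski_closure_subset_proj_space) auto
  moreover have "proj_space (pairs A) \<subseteq> zariski_closure (pairs A) (projectivization (vecs (pairs A)))"
    unfolding zariski_closure_def proj_space_def by (rule hull_subset)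
  ultimately show ?thesis
    using True nondegenerate_Grass2[OF assms] unfolding Sec_def by auto
next
  case False
  then show ?thesis
    using Union_secant_spaces_Grass2[OF assms, of k] by (simp add: Sec_def del: wedge_sums.simps)
qed

section \<open>Cones\<close>

lemma restrict_vec_mem_vecs: "restrict_vec J y \<in> vecs J"
  by (auto simp: restrict_vec_def vecs_def)

lemma restrict_vec_cscale: "restrict_vec J (cscale c y) = cscale c (restrict_vec J y)"
  by (auto simp: restrict_vec_def cscale_def)

lemma restrict_vec_eq_zero_iff: "restrict_vec J y = 0 \<longleftrightarrow> (\<forall>i\<in>J. y i = 0)"
  by (auto simp: restrict_vec_def fun_eq_iff)

lemma mem_cone_iff:
  "P \<in> cone I J W \<longleftrightarrow> (\<exists>y\<in>vecs I - {0}. P = proj_point y \<and>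
     (restrict_vec J y = 0 \<or> proj_point (restrict_vec J y) \<in> W))"
  unfolding cone_def vertex_def projectivization_def restrict_vec_eq_zero_iff by blast

lemma proj_point_mem_cone_iff:
  "proj_point y \<in> cone I J W \<longleftrightarrow>
     y \<in> vecs I - {0} \<and> (restrict_vec J y = 0 \<or> proj_point (restrict_vec J y) \<in> W)"
proof
  assume "proj_point y \<in> cone I J W"
  then obtain z c where z: "z \<in> vecs I - {0}" "y = cscale c z" "c \<noteq> 0"
    "restrict_vec J z = 0 \<or> proj_point (restrict_vec J z) \<in> W"
    unfolding mem_cone_iff proj_point_eq_iff by blast
  then show "y \<in> vecs I - {0} \<and> (restrict_vec J y = 0 \<or> proj_point (restrict_vec J y) \<in> W)"
    using cvec.subspace_scale[OF subspace_vecs]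
    by (auto simp: restrict_vec_cscale proj_point_cscale)
qed (auto simp: mem_cone_iff)

text \<open>Equations of \<open>V\<close> become equations of the slice by restricting coordinates.
  Conversely, an equation of the slice \<open>y p = 1\<close> holds on the whole cone over
  \<open>V\<close>, and its graded pieces in the coordinates of \<open>J\<close>, the others frozen,
  are equations of \<open>V\<close>.\<close>

lemma zariski_closure_cone:
  assumes I: "finite I" and J: "J \<subseteq> I" and p: "p \<in> I - J"
    and V: "V \<subseteq> vecs J" "0 \<in> V" "\<And>c x. x \<in> V \<Longrightarrow> cscale c x \<in> V"
  shows "zariski_closure I (proj_point ` {y \<in> vecs I. y p = 1 \<and> restrict_vec J y \<in> V}) =
    cone I J (zariski_closure J (projectivization V))"
    (is "zariski_closure I (proj_point ` ?T) = cone I J ?W")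
proof -
  have finJ: "finite J" using I J finite_subset by blast
  have T: "?T \<subseteq> vecs I - {0}" by auto
  note W_iff = affine_cone_zariski_closure_iff[OF finJ V(1,2) restrict_vec_mem_vecs]
  have "proj_point y \<in> zariski_closure I (proj_point ` ?T) \<longleftrightarrow> proj_point y \<in> cone I J ?W" for y
    unfolding zariski_closure_iff[OF T] proj_point_mem_cone_iff W_iff
  proof (intro conj_cong refl iffI allI ballI impI)
    fix d f assume y: "y \<in> vecs I - {0}"
      and L: "\<forall>d. \<forall>f\<in>forms I d. (\<forall>t\<in>?T. f t = 0) \<longrightarrow> f y = 0"
      and f: "f \<in> forms J d" "\<forall>t\<in>V. f t = 0"
    have "(\<lambda>x. restrict_vec J x j) \<in> forms I 1" if "j \<in> J" for j
      using that J forms_coord[OF I, of j] by (auto simp: restrict_vec_def)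
    from forms_compose[OF I f(1) this]
    have "(\<lambda>x. f (restrict_vec J x)) \<in> forms I d" by simp
    then show "f (restrict_vec J y) = 0"
      using L[rule_format, of "\<lambda>x. f (restrict_vec J x)"] f(2) by blast
  next
    fix d f assume y: "y \<in> vecs I - {0}"
      and R: "\<forall>d. \<forall>f\<in>forms J d. (\<forall>t\<in>V. f t = 0) \<longrightarrow> f (restrict_vec J y) = 0"
      and f: "f \<in> forms I d" "\<forall>t\<in>?T. f t = 0"
    \<comment> \<open>By homogeneity this holds for \<open>z p \<noteq> 0\<close>, hence in general.\<close>
    have fV: "f z = 0" if z: "z \<in> vecs I" "restrict_vec J z \<in> V" for z
    proof (rule forms_zero_by_continuity[OF f(1), where i = p])
      fix t :: complex assume t: "t \<noteq> 0"
      have "restrict_vec J (z(p := t)) = restrict_vec J z"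
        using p by (auto simp: restrict_vec_def)
      then have "restrict_vec J (cscale (1 / t) (z(p := t))) \<in> V"
        using V(3) z(2) by (simp add: restrict_vec_cscale)
      moreover have "z(p := t) \<in> vecs I"
        using z(1) p by (auto simp: vecs_def)
      then have "cscale (1 / t) (z(p := t)) \<in> vecs I"
        by (rule cvec.subspace_scale[OF subspace_vecs])
      moreover have "cscale (1 / t) (z(p := t)) p = 1"
        using t by (simp add: cscale_def)
      ultimately have "cscale (1 / t) (z(p := t)) \<in> ?T" by blast
      then have "(1 / t) ^ d * f (z(p := t)) = 0"
        using f(2) by (subst forms_cscale[OF f(1), symmetric]) blast
      then show "f (z(p := t)) = 0" using t by simp
    qed
    obtain h where h: "\<And>e. h e \<in> forms J e"
      and f_eq: "\<And>z. f (\<lambda>i. if i \<in> J then z i else y i) = (\<Sum>e\<le>d. h e z)"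
      using forms_graded_restriction[OF I J f(1)] by metis
    have "h e z = 0" if z: "z \<in> V" and e: "e \<le> d" for e z
    proof -
      \<comment> \<open>\<open>V\<close> is closed under scaling, so the coordinates in
        \<open>J\<close> may be scaled by any \<open>s\<close> with the others fixed. A polynomial
        in \<open>s\<close> that vanishes everywhere has zero coefficients.\<close>
      have "(\<Sum>e\<le>d. h e z * s ^ e) = 0" for s
      proof -
        let ?w = "\<lambda>i. if i \<in> J then cscale s z i else y i"
        have "restrict_vec J ?w = cscale s z"
          using V(1,3) z by (fastforce simp: restrict_vec_def vecs_def)
        moreover have "?w \<in> vecs I"
          using y J by (auto simp: vecs_def)
        ultimately have "f ?w = 0"
          using fV V(3) z by simp
        then show ?thesis
          unfolding f_eq by (simp add: forms_cscale[OF h] mult.commute)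
      qed
      then show ?thesis
        using e polyfun_eq_0[of "\<lambda>e. h e z" d] by blast
    qed
    \<comment> \<open>Each graded piece is an equation of \<open>V\<close>, so it also holds at the
      restriction of \<open>y\<close>.\<close>
    then have "h e (restrict_vec J y) = 0" if "e \<le> d" for e
      using R h that by blast
    moreover have "(\<lambda>i. if i \<in> J then restrict_vec J y i else y i) = y"
      by (auto simp: restrict_vec_def)
    ultimately show "f y = 0"
      using f_eq[of "restrict_vec J y"] by simp
  qed
  moreover have "\<exists>y. P = proj_point y" if "P \<in> zariski_closure I (proj_point ` ?T)" for P
    using that zariski_closure_subset_proj_space[OF T]
    by (auto simp: proj_space_def projectivization_def)
  ultimately show ?thesis
    by (blast dest: mem_cone_iff[THEN iffD1])
qed

section \<open>The image under the Cremona transformation\<close>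

lemma cremona_image_chart01:
  assumes "S \<subseteq> proj_space (pairs {0..<n})"
  shows "cremona n ` (S \<inter> chart01 n) = proj_point ` cremona_affine n `
    {x \<in> vecs (pairs {0..<n}). x (0, 1) = 1 \<and> proj_point x \<in> S}"
proof (intro equalityI subsetI)
  fix Q assume "Q \<in> cremona n ` (S \<inter> chart01 n)"
  then obtain P where P: "P \<in> S" "P \<in> chart01 n" "Q = cremona n P" by blast
  then obtain z where z: "P = proj_point z" "z \<in> vecs (pairs {0..<n})"
    using assms by (auto simp: proj_space_def projectivization_def)
  have z01: "z (0, 1) \<noteq> 0"
    using P(2) mem_proj_point[of z] by (auto simp: chart01_def z(1))
  define x where "x = cscale (1 / z (0, 1)) z"
  have x: "proj_point x = P" "x \<in> vecs (pairs {0..<n})" "x (0, 1) = 1"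
    using z z01 cvec.subspace_scale[OF subspace_vecs]
    by (auto simp: x_def proj_point_cscale) (auto simp: cscale_def)
  then show "Q \<in> proj_point ` cremona_affine n `
      {x \<in> vecs (pairs {0..<n}). x (0, 1) = 1 \<and> proj_point x \<in> S}"
    using P(1,3) cremona_proj_point[of x, OF x(3)] by blast
next
  fix Q assume "Q \<in> proj_point ` cremona_affine n `
      {x \<in> vecs (pairs {0..<n}). x (0, 1) = 1 \<and> proj_point x \<in> S}"
  then obtain x where x: "Q = proj_point (cremona_affine n x)" "x (0, 1) = 1" "proj_point x \<in> S"
    by blast
  then have "proj_point x \<in> chart01 n"
    using assms by (auto simp: chart01_def proj_point_def cscale_def)
  then show "Q \<in> cremona n ` (S \<inter> chart01 n)"
    using x cremona_proj_point[of x, OF x(2)] by (metis IntI imageI)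
qed

lemma cremona_affine_mem_vecs: "cremona_affine n x \<in> vecs (pairs {0..<n})"
  by (auto simp: cremona_affine_def vecs_def)

lemma cremona_affine_01:
  assumes "n \<ge> 2"
  shows "cremona_affine n x (0, 1) = 1"
  using assms by (simp add: cremona_affine_def pairs_def)

lemma restrict_vec_cremona_affine:
  assumes "x (0, 1) = 1"
  shows "restrict_vec (pairs {2..<n}) (cremona_affine n x) = schur n x"
  using assms by (auto simp: restrict_vec_def cremona_affine_def schur_def pairs_def fun_eq_iff)

text \<open>On this slice rows 0 and 1 are kept and the other entries become the Schur complement.
  The two Schur complement lemmas give the two inclusions.\<close>

lemma cremona_affine_image_wedge_sums:
  assumes n: "n \<ge> 2"
  shows "cremona_affine n ` {x \<in> wedge_sums {0..<n} (Suc k). x (0, 1) = 1} =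
    {y \<in> vecs (pairs {0..<n}). y (0, 1) = 1 \<and> restrict_vec (pairs {2..<n}) y \<in> wedge_sums {2..<n} k}"
    (is "?L = ?R")
proof (intro equalityI subsetI)
  fix y assume "y \<in> ?L"
  then obtain x where x: "y = cremona_affine n x" "x \<in> wedge_sums {0..<n} (Suc k)" "x (0, 1) = 1"
    by blast
  then show "y \<in> ?R"
    using schur_mem_wedge_sums[of x, OF x(2,3)] restrict_vec_cremona_affine[of x n, OF x(3)]
      cremona_affine_mem_vecs cremona_affine_01[OF n] by simp
next
  fix y assume y: "y \<in> ?R"
  \<comment> \<open>The inverse of the affine formula: the quadratic terms involve only the
    unchanged rows 0 and 1, so they can be added back.\<close>
  define x where "x = (\<lambda>(i, j). if (i, j) \<in> pairs {2..<n}
    then y (i, j) + y (0, i) * y (1, j) - y (0, j) * y (1, i) else y (i, j))"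
  have x01: "x (0, 1) = 1" using y by (simp add: x_def pairs_def)
  have x_vec: "x \<in> vecs (pairs {0..<n})"
    using y by (auto simp: x_def vecs_def pairs_def)
  have y_eq: "y = cremona_affine n x"
  proof
    fix p :: "nat \<times> nat"
    obtain i j where p: "p = (i, j)" by fastforce
    show "y p = cremona_affine n x p"
      using y by (auto simp: p x_def cremona_affine_def vecs_def pairs_def)
  qed
  then have "schur n x \<in> wedge_sums {2..<n} k"
    using y restrict_vec_cremona_affine[of x n, OF x01] by simp
  then have "x \<in> wedge_sums {0..<n} (Suc k)"
    by (rule mem_wedge_sums_if_schur[OF x_vec x01])
  then show "y \<in> ?L" using x01 y_eq by blast
qed

lemma cremona_image_wedge_sums:
  assumes n: "n \<ge> 2"
  shows "cremona n ` (projectivization (wedge_sums {0..<n} (Suc k)) \<inter> chart01 n) =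
    proj_point ` {y \<in> vecs (pairs {0..<n}). y (0, 1) = 1 \<and>
      restrict_vec (pairs {2..<n}) y \<in> wedge_sums {2..<n} k}"
proof -
  have "projectivization (wedge_sums {0..<n} (Suc k)) \<subseteq> proj_space (pairs {0..<n})"
    unfolding proj_space_def projectivization_def
    using wedge_sums_subset_vecs[of "{0..<n}" "Suc k"] by blast
  moreover have "{x \<in> vecs (pairs {0..<n}). x (0, 1) = 1 \<and>
      proj_point x \<in> projectivization (wedge_sums {0..<n} (Suc k))} =
    {x \<in> wedge_sums {0..<n} (Suc k). x (0, 1) = 1}"
    unfolding proj_point_mem_wedge_sums_iff
    using wedge_sums_subset_vecs[of "{0..<n}" "Suc k"] by fastforce
  ultimately show ?thesis
    by (simp only: cremona_image_chart01 cremona_affine_image_wedge_sums[OF n])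
qed

lemma zariski_closure_wedge_sums_cone:
  assumes "n \<ge> 2"
  shows "zariski_closure (pairs {0..<n}) (proj_point ` {y \<in> vecs (pairs {0..<n}).
      y (0, 1) = 1 \<and> restrict_vec (pairs {2..<n}) y \<in> wedge_sums {2..<n} k}) =
    cone (pairs {0..<n}) (pairs {2..<n})
      (zariski_closure (pairs {2..<n}) (projectivization (wedge_sums {2..<n} k)))"
proof (rule zariski_closure_cone)
  show "pairs {2..<n} \<subseteq> pairs {0..<n}" "(0, 1) \<in> pairs {0..<n} - pairs {2..<n}"
    using assms by (auto simp: pairs_def)
qed (simp_all only: finite_pairs finite_atLeastLessThan wedge_sums_subset_vecs
    zero_mem_wedge_sums wedge_sums_cscale)

text \<open>For one decomposable summand the Schur complement is zero, so the cone has empty base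
  and only its vertex remains.\<close>

lemma cremona_image_Grass2:
  assumes "n \<ge> 2"
  shows "cremona_image n (Grass2 {0..<n}) = vertex (pairs {0..<n}) (pairs {2..<n})"
proof -
  \<comment> \<open>The constant form 1 vanishes nowhere, so the empty set is closed.\<close>
  have "zariski_closure (pairs {2..<n}) {} = {}"
  proof -
    have "proj_point x \<notin> zariski_closure (pairs {2..<n}) (proj_point ` {})" for x
      using zariski_closure_iff[of "{}" "pairs {2..<n}" x] forms_one[OF finite_pairs[of "{2..<n}"]]
      by fastforce
    then show ?thesis
      using zariski_closure_subset_proj_space[of "{}" "pairs {2..<n}"]
      by (auto simp: proj_space_def projectivization_def)
  qed
  then show ?thesis
    unfolding cremona_image_def Grass2_eq cremona_image_wedge_sums[OF assms]
      zariski_closure_wedge_sums_cone[OF assms]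
    by (simp add: projectivization_def cone_def)
qed

text \<open>The vertex comes from the coordinate subspace on \<open>I - J\<close>. Strict inclusion
  keeps it nonempty, so that subtracting 1 is exact.\<close>

lemma linear_space_vertex:
  assumes "finite I" "J \<subset> I"
  shows "linear_space I (card (I - J) - 1) (vertex I J)"
proof -
  have "{y \<in> vecs I. \<forall>i\<in>J. y i = 0} = vecs (I - J)"
    by (auto simp: vecs_def)
  moreover have "card (I - J) \<ge> 1"
    using assms by (auto simp: Suc_le_eq card_gt_0_iff)
  moreover have "vecs (I - J) \<subseteq> vecs I" by (auto simp: vecs_def)
  ultimately show ?thesis
    unfolding linear_space_def vertex_def using assms
    by (intro exI[of _ "vecs (I - J)"]) (auto simp: subspace_vecs dim_vecs)
qed

theorem mainTheorem4:
  fixes n k :: nat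
  assumes "n \<ge> 4" and "k \<ge> 1"
  shows "cremona_image n (Sec (pairs {0..<n}) k (Grass2 {0..<n})) =
           cone (pairs {0..<n}) (pairs {2..<n}) (Sec (pairs {2..<n}) (k - 1) (Grass2 {2..<n}))
       \<and> cremona_image n (Grass2 {0..<n}) = vertex (pairs {0..<n}) (pairs {2..<n})
       \<and> (\<exists>d. linear_space (pairs {0..<n}) d (vertex (pairs {0..<n}) (pairs {2..<n})))"
proof -
  let ?I = "pairs {0..<n}" and ?J = "pairs {2..<n}"
  let ?V = "wedge_sums {0..<n} (Suc k)" and ?V' = "wedge_sums {2..<n} k"
  let ?S = "zariski_closure ?I (projectivization ?V)"
  let ?W = "zariski_closure ?J (projectivization ?V')"
  have n: "n \<ge> 2" using assms by simp
  have I: "finite ?I" by (simp add: finite_pairs)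
  have S: "Sec ?I k (Grass2 {0..<n}) = ?S" by (simp only: Sec_Grass2 finite_atLeastLessThan)
  have W: "Sec ?J (k - 1) (Grass2 {2..<n}) = ?W"
    using Sec_Grass2[of "{2..<n}" "k - 1"] assms(2) by simp
  \<comment> \<open>\<open>T\<close> represents the image of the sums in the chart and
    \<open>T'\<close> that of their closure; it remains to see that both images have the same
    closure.\<close>
  define T where "T = {y \<in> vecs ?I. y (0, 1) = 1 \<and> restrict_vec ?J y \<in> ?V'}"
  define T' where "T' = cremona_affine n ` {x \<in> vecs ?I. x (0, 1) = 1 \<and> proj_point x \<in> ?S}"
  have V: "?V - {0} \<subseteq> vecs ?I - {0}"
    using wedge_sums_subset_vecs by blast
  have S_sub: "?S \<subseteq> proj_space ?I"
    unfolding projectivization_def by (rule zariski_closure_subset_proj_space[OF V])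
  have TI: "T \<subseteq> vecs ?I - {0}"
    by (auto simp: T_def)
  have "cremona_affine n x \<noteq> 0" for x
    using cremona_affine_01[OF n, of x] by auto
  then have T'I: "T' \<subseteq> vecs ?I - {0}"
    using cremona_affine_mem_vecs by (auto simp: T'_def)
  have closT: "zariski_closure ?I (proj_point ` T) = cone ?I ?J ?W"
    unfolding T_def by (rule zariski_closure_wedge_sums_cone[OF n])
  have imS: "cremona n ` (?S \<inter> chart01 n) = proj_point ` T'"
    unfolding T'_def by (rule cremona_image_chart01[OF S_sub])
  have "cremona_image n ?S = cone ?I ?J ?W"
  proof
    have "proj_point y \<in> cone ?I ?J ?W" if y: "y \<in> T'" for y
    proof -
      obtain x where x: "y = cremona_affine n x" "x (0, 1) = 1" "proj_point x \<in> ?S"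
        using y by (auto simp: T'_def simp del: wedge_sums.simps)
      \<comment> \<open>The Schur complement is quadratic, so it pulls back the equations of the affine cone
        over \<open>?W\<close> to equations of \<open>?S\<close>.\<close>
      have "f (schur n x) = 0" if f: "f \<in> forms ?J d" "\<forall>t\<in>?V'. f t = 0" for f d
      proof -
        have "(\<lambda>x. schur n x p) \<in> forms ?I (1 + 1)" if "p \<in> ?J" for p
        proof -
          obtain i j where p: "p = (i, j)" by fastforce
          have "(0, 1) \<in> ?I" "(i, j) \<in> ?I" "(0, i) \<in> ?I" "(1, j) \<in> ?I" "(0, j) \<in> ?I" "(1, i) \<in> ?I"
            using that by (auto simp: p pairs_def)
          then show ?thesis
            using that I unfolding p schur_def
            by (simp only: prod.case if_True) (intro forms_add forms_diff forms_mult forms_coord)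
        qed
        from forms_compose[OF I f(1) this]
        have "(\<lambda>x. f (schur n x)) \<in> forms ?I ((1 + 1) * d)" by simp
        moreover have "\<forall>t\<in>?V - {0}. f (schur n t) = 0"
          using f(2) schur_mem_wedge_sums_of_pos[OF _ assms(2)] by blast
        moreover have "\<forall>d. \<forall>f\<in>forms ?I d. (\<forall>t\<in>?V - {0}. f t = 0) \<longrightarrow> f x = 0"
          using x(3) unfolding projectivization_def zariski_closure_iff[OF V] by (rule conjunct2)
        ultimately show ?thesis by meson
      qed
      then have "schur n x = 0 \<or> proj_point (schur n x) \<in> ?W"
        using restrict_vec_mem_vecs[of ?J "cremona_affine n x"]
        unfolding restrict_vec_cremona_affine[of x n, OF x(2)]
        by (subst affine_cone_zariski_closure_iff)
          (auto intro: finite_pairs zero_mem_wedge_sums dest: subsetD[OF wedge_sums_subset_vecs])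
      then show ?thesis
        using T'I y restrict_vec_cremona_affine[of x n, OF x(2)]
        unfolding proj_point_mem_cone_iff x(1) by auto
    qed
    then show "cremona_image n ?S \<subseteq> cone ?I ?J ?W"
      unfolding cremona_image_def imS closT[symmetric]
      by (intro zariski_closure_subset[OF TI T'I]) blast
    \<comment> \<open>For the reverse inclusion the sums themselves suffice, since the closure of
      their image is already the cone.\<close>
    have "projectivization ?V \<subseteq> ?S"
      unfolding zariski_closure_def by (rule hull_subset)
    then have "cremona n ` (projectivization ?V \<inter> chart01 n) \<subseteq> cremona n ` (?S \<inter> chart01 n)"
      by blast
    then show "cone ?I ?J ?W \<subseteq> cremona_image n ?S"
      unfolding cremona_image_def closT[symmetric] T_def cremona_image_wedge_sums[OF n, symmetric]
      by (rule zariski_closure_mono)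
  qed
  moreover have "?J \<subset> ?I"
  proof -
    have "(0, 1) \<in> ?I" "(0, 1) \<notin> ?J" using n by (auto simp: pairs_def)
    moreover have "?J \<subseteq> ?I" by (auto simp: pairs_def)
    ultimately show ?thesis by blast
  qed
  ultimately show ?thesis
    using cremona_image_Grass2[OF n] linear_space_vertex[OF I] unfolding S W by blast
qed

end
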